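(* Let $d\ge1$, $T>0$, let $g:[0,\infty)\to\mathbb{R}$ be smooth and non-decreasing, and let $H:\mathbb{R}^d\to\mathbb{R}$ be smooth and convex. Let $u,m\in C^\infty(\mathbb{T}^d\times[0,T])$ with $m\ge0$ (both periodic in $x$) solve $$\begin{cases}-u_t+H(Du)=g(m),\\ m_t-\operatorname{div}\big(m\,D_pH(Du)\big)=0,\end{cases}\qquad (x,t)\in\mathbb{T}^d\times(0,T),$$ and write $m^0=m(\cdot,0)$ and $m^T=m(\cdot,T)$. Then, for all $1\le q\le\infty$, $$\|m(\cdot,t)\|_{L^q(\mathbb{T}^d)}\le\|m^0\|_{L^q(\mathbb{T}^d)}^{1-\frac tT}\,\|m^T\|_{L^q(\mathbb{T}^d)}^{\frac tT}\qquad\text{for all }t\in[0,T].$$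
   Context: $\mathbb{T}^d=\mathbb{R}^d/\mathbb{Z}^d$ is the $d$-dimensional flat torus (of Lebesgue measure $1$); functions on $\mathbb{T}^d$ are identified with $\mathbb{Z}^d$-periodic functions on $\mathbb{R}^d$. $D$ and $\operatorname{div}$ denote the gradient and divergence in the space variable $x$; the subscript $t$ denotes the time derivative; $D_pH$ is the gradient of $H=H(p)$. The convention $0^0=1$ is used if needed. *)

theory Defs
  imports "HOL-Analysis.Analysis" "HOL-Probability.Essential_Supremum"
begin

text \<open>
  \<open>C\<^sup>k\<close> regularity up to the boundary. Derivatives are taken within \<open>S\<close>, so this is meant for
  sets on which they are unique, such as convex sets with nonempty interior; there it
  says that all partial derivatives up to order \<open>k\<close> exist and are continuous on \<open>S\<close>
  (one-sided at boundary points). Only the values of \<open>f\<close> on \<open>S\<close> matter.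
\<close>

primrec Ck_on ::
  "nat \<Rightarrow> ('a::euclidean_space \<Rightarrow> real) \<Rightarrow> 'a set \<Rightarrow> bool" where
  "Ck_on 0 f S \<longleftrightarrow> continuous_on S f"
| "Ck_on (Suc k) f S \<longleftrightarrow>
     (\<exists>f'. (\<forall>x\<in>S. (f has_derivative f' x) (at x within S)) \<and>
           (\<forall>v. Ck_on k (\<lambda>x. f' x v) S))"

definition smooth_on :: "('a::euclidean_space \<Rightarrow> real) \<Rightarrow> 'a set \<Rightarrow> bool" where
  "smooth_on f S \<longleftrightarrow> (\<forall>k. Ck_on k f S)"

definition grad :: "('a::euclidean_space \<Rightarrow> real) \<Rightarrow> 'a \<Rightarrow> 'a" where
  "grad f x = (THE D. GDERIV f x :> D)"

definition divergence :: "(real^'n \<Rightarrow> real^'n) \<Rightarrow> real^'n \<Rightarrow> real" where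
  "divergence F x = (\<Sum>i\<in>UNIV. frechet_derivative F (at x) (axis i 1) $ i)"

definition Zn_periodic :: "(real^'n \<Rightarrow> 'b) \<Rightarrow> bool" where
  "Zn_periodic f \<longleftrightarrow> (\<forall>x k. (\<forall>i. k $ i \<in> \<int>) \<longrightarrow> f (x + k) = f x)"

text \<open>
  Functions on the flat torus are \<open>\<int>\<^sup>n\<close>-periodic functions, and the measure of the torus is
  Lebesgue measure on the unit cube (the overlap of its faces is a null set).
\<close>

abbreviation torus_measure :: "(real^'n) measure" where
  "torus_measure \<equiv> lebesgue_on (cbox 0 1)"

text \<open>
  The real-valued \<open>L\<^sup>q\<close> norm, \<open>1 \<le> q \<le> \<infinity>\<close>, for functions whose norm is finite
  (a norm that is infinite is sent to 0 by the integral and by \<^const>\<open>enn2real\<close>).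
\<close>

definition Lq_norm :: "ennreal \<Rightarrow> (real^'n \<Rightarrow> real) \<Rightarrow> real" where
  "Lq_norm q f =
     (if q = \<infinity> then enn2real (esssup torus_measure (\<lambda>x. ennreal \<bar>f x\<bar>))
      else (LINT x|torus_measure. \<bar>f x\<bar> powr enn2real q) powr (1 / enn2real q))"

text \<open>Real powers with \<open>0\<^sup>0 = 1\<close>, whereas \<open>0 powr 0 = 0\<close>.\<close>

definition rpow :: "real \<Rightarrow> real \<Rightarrow> real" where
  "rpow a s = (if s = 0 then 1 else a powr s)"

end

theory Submission
  imports Defs
begin

text \<open>
  Write \<open>v = D\<^sub>pH(Du)\<close>, \<open>P = m\<^sup>q\<close> and \<open>\<phi>(t) = \<integral>P\<close>. The continuity equation reads
  \<open>P\<^sub>t = DP\<cdot>v + q P div v\<close>, so \<open>\<phi>' = (q - 1) \<integral>P div v\<close>. Differentiating the Hamilton-Jacobi equation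
  gives \<open>v\<^sub>t = (Dv)v - g'(m) D\<^sup>2H Dm\<close>; hence, up to a divergence, \<open>(P div v)\<^sub>t\<close> equals
  \<open>(q - 1) P (div v)\<^sup>2 + P tr((Dv)\<^sup>2) + g'(m) DP\<cdot>D\<^sup>2H Dm\<close>. The last two terms are nonnegative because
  \<open>Dv = D\<^sup>2H D\<^sup>2u\<close> is the product of a positive semidefinite and a symmetric matrix. Cauchy-Schwarz then
  yields \<open>\<phi>'\<^sup>2 \<le> \<phi> \<phi>''\<close>, that is, log-convexity of \<open>\<phi>\<close>. The case \<open>q = \<infinity>\<close> is the limit \<open>q \<rightarrow> \<infinity>\<close>.
\<close>

section \<open>Calculus of \<open>C\<^sup>k\<close> functions\<close>

text \<open>The constants in the chain match exactly. With I1 the integral of P div v and J that of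
  P (div v)^2, one has \<phi>' = (q - 1) I1 and \<phi>'' >= (q - 1)^2 J, while Cauchy-Schwarz gives
  I1^2 <= \<phi> J; both sides thus carry the same factor (q - 1)^2. Since Dv is not symmetric, the
  sign of tr((Dv)^2) is not obvious. Writing D^2H = C^T C and B = D^2u, cyclicity of the trace turns
  it into the squared Frobenius norm of the symmetric matrix C B C^T. Zeros of m shape the argument:
  P loses regularity there and \<phi> may vanish. So all second derivatives are made to fall on the
  smooth field v, and the logarithm is applied to \<phi> + e. The equations hold only for 0 < t < T.
  All differentiation therefore takes place on the open strip, and the times 0 and T are reached by
  continuity alone. For q = \<infinity>, full convergence of the norms is avoided: L^q norms are
  bounded above by the sup norm at the two end times, and below at time t.\<close>

lemma Ck_on_cong: "(\<And>x. x \<in> S \<Longrightarrow> f x = g x) \<Longrightarrow> Ck_on k f S \<longleftrightarrow> Ck_on k g S"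
proof (induction k arbitrary: f g)
  case 0
  then show ?case by (simp cong: continuous_on_cong)
next
  case (Suc k)
  have "(f has_derivative D) (at x within S) \<longleftrightarrow> (g has_derivative D) (at x within S)"
    if "x \<in> S" for x D
    using that Suc.prems has_derivative_transform[of x S f g] has_derivative_transform[of x S g f] by auto
  then show ?case by (auto cong: conj_cong ball_cong)
qed

lemma Ck_on_subset: "Ck_on k f S \<Longrightarrow> S' \<subseteq> S \<Longrightarrow> Ck_on k f S'"
proof (induction k arbitrary: f)
  case 0
  then show ?case by (auto intro: continuous_on_subset)
next
  case (Suc k)
  then obtain f' where "\<forall>x\<in>S. (f has_derivative f' x) (at x within S)" "\<forall>v. Ck_on k (\<lambda>x. f' x v) S"
    by auto
  with Suc show ?case by (auto intro!: exI[of _ f'] intro: has_derivative_subset)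
qed

lemma Ck_on_SucD: "Ck_on (Suc k) f S \<Longrightarrow> Ck_on k f S"
proof (induction k arbitrary: f)
  case 0
  then show ?case
    by (auto simp: continuous_on_eq_continuous_within intro: has_derivative_continuous)
next
  case (Suc k)
  then obtain f' where "\<forall>x\<in>S. (f has_derivative f' x) (at x within S)" "\<forall>v. Ck_on (Suc k) (\<lambda>x. f' x v) S"
    by auto
  with Suc.IH show ?case unfolding Ck_on.simps(2)[of k f] by blast
qed

lemma Ck_on_imp_continuous_on: "Ck_on k f S \<Longrightarrow> continuous_on S f"
proof (induction k)
  case (Suc k)
  then show ?case using Ck_on_SucD by blast
qed simp

lemma Ck_on_const: "Ck_on k (\<lambda>x. c) S"
proof (induction k arbitrary: c)
  case (Suc k)
  then show ?case by (auto intro!: exI[of _ "\<lambda>x v. 0"])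
qed simp

lemma Ck_on_add: "Ck_on k f S \<Longrightarrow> Ck_on k g S \<Longrightarrow> Ck_on k (\<lambda>x. f x + g x) S"
proof (induction k arbitrary: f g)
  case 0
  then show ?case by (auto intro: continuous_on_add)
next
  case (Suc k)
  then obtain f' g' where
    "\<forall>x\<in>S. (f has_derivative f' x) (at x within S)" "\<forall>v. Ck_on k (\<lambda>x. f' x v) S"
    "\<forall>x\<in>S. (g has_derivative g' x) (at x within S)" "\<forall>v. Ck_on k (\<lambda>x. g' x v) S"
    by auto
  with Suc.IH show ?case
    by (auto intro!: exI[of _ "\<lambda>x v. f' x v + g' x v"] has_derivative_add)
qed

lemma Ck_on_mult: "Ck_on k f S \<Longrightarrow> Ck_on k g S \<Longrightarrow> Ck_on k (\<lambda>x. f x * g x) S"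
proof (induction k arbitrary: f g)
  case 0
  then show ?case by (auto intro: continuous_on_mult)
next
  case (Suc k)
  then obtain f' g' where
    "\<forall>x\<in>S. (f has_derivative f' x) (at x within S)" "\<forall>v. Ck_on k (\<lambda>x. f' x v) S"
    "\<forall>x\<in>S. (g has_derivative g' x) (at x within S)" "\<forall>v. Ck_on k (\<lambda>x. g' x v) S"
    by auto
  with Suc Ck_on_SucD[OF Suc.prems(1)] Ck_on_SucD[OF Suc.prems(2)] show ?case
    by (auto intro!: exI[of _ "\<lambda>x v. f x * g' x v + f' x v * g x"] has_derivative_mult Ck_on_add)
qed

lemma Ck_on_minus: "Ck_on k f S \<Longrightarrow> Ck_on k (\<lambda>x. - f x) S"
  using Ck_on_mult[OF Ck_on_const[of k "-1"]] by simp

lemma Ck_on_diff: "Ck_on k f S \<Longrightarrow> Ck_on k g S \<Longrightarrow> Ck_on k (\<lambda>x. f x - g x) S"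
  using Ck_on_add[OF _ Ck_on_minus, of k f S g] by simp

lemma Ck_on_sum: "(\<And>i. i \<in> I \<Longrightarrow> Ck_on k (f i) S) \<Longrightarrow> Ck_on k (\<lambda>x. \<Sum>i\<in>I. f i x) S"
  by (induction I rule: infinite_finite_induct) (auto intro: Ck_on_const Ck_on_add)

text \<open>\<open>Ck_on\<close> speaks of real-valued functions, so regularity of the inner map is
  stated coordinatewise. The chain rule writes the derivative as a finite sum of products of order
  \<open>k\<close>, to which the induction applies with \<open>f\<close> replaced by its partial
  derivatives.\<close>

lemma Ck_on_compose:
  fixes f :: "'b::euclidean_space \<Rightarrow> real" and p :: "'a::euclidean_space \<Rightarrow> 'b"
  assumes "Ck_on k f S'" "\<And>b. b \<in> Basis \<Longrightarrow> Ck_on k (\<lambda>x. p x \<bullet> b) S" "p ` S \<subseteq> S'"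
  shows "Ck_on k (\<lambda>x. f (p x)) S"
  using assms
proof (induction k arbitrary: f)
  case 0
  have "continuous_on S p"
    using 0 by (subst continuous_on_componentwise) auto
  then show ?case using 0 by (auto intro: continuous_on_compose2)
next
  case (Suc k)
  obtain f' where f': "\<forall>x\<in>S'. (f has_derivative f' x) (at x within S')" "\<forall>v. Ck_on k (\<lambda>x. f' x v) S'"
    using Suc.prems(1) by auto
  have "\<forall>b\<in>Basis. \<exists>p'. (\<forall>x\<in>S. ((\<lambda>x. p x \<bullet> b) has_derivative p' x) (at x within S)) \<and> (\<forall>v. Ck_on k (\<lambda>x. p' x v) S)"
    using Suc.prems(2) by auto
  then obtain p' where p': "\<And>b x. b \<in> Basis \<Longrightarrow> x \<in> S \<Longrightarrow> ((\<lambda>x. p x \<bullet> b) has_derivative p' b x) (at x within S)"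
      "\<And>b v. b \<in> Basis \<Longrightarrow> Ck_on k (\<lambda>x. p' b x v) S"
    by metis
  have dp: "(p has_derivative (\<lambda>h. \<Sum>b\<in>Basis. p' b x h *\<^sub>R b)) (at x within S)" if "x \<in> S" for x
    using that p'(1) by (subst has_derivative_componentwise_within) auto
  show ?case unfolding Ck_on.simps
  proof (intro exI[of _ "\<lambda>x h. \<Sum>b\<in>Basis. p' b x h * f' (p x) b"] conjI ballI allI)
    fix x assume x: "x \<in> S"
    then have fx: "(f has_derivative f' (p x)) (at (p x) within S')" using f' Suc.prems(3) by auto
    then have "bounded_linear (f' (p x))" by (rule has_derivative_bounded_linear)
    then have eq: "f' (p x) (\<Sum>b\<in>Basis. c b *\<^sub>R b) = (\<Sum>b\<in>Basis. c b * f' (p x) b)" for c :: "'b \<Rightarrow> real"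
      by (simp add: linear_sum linear_cmul bounded_linear.linear)
    have "((\<lambda>x. f (p x)) has_derivative (\<lambda>h. f' (p x) (\<Sum>b\<in>Basis. p' b x h *\<^sub>R b))) (at x within S)"
      by (rule has_derivative_in_compose[OF dp[OF x] has_derivative_subset[OF fx Suc.prems(3)]])
    then show "((\<lambda>x. f (p x)) has_derivative (\<lambda>h. \<Sum>b\<in>Basis. p' b x h * f' (p x) b)) (at x within S)"
      by (simp add: eq)
  next
    fix v
    have "Ck_on k (\<lambda>x. f' (p x) b) S" for b
      using Suc.IH[of "\<lambda>y. f' y b"] f'(2) Suc.prems Ck_on_SucD by blast
    then show "Ck_on k (\<lambda>x. \<Sum>b\<in>Basis. p' b x v * f' (p x) b) S"
      by (intro Ck_on_sum Ck_on_mult p'(2))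
  qed
qed

text \<open>Picks one derivative in place of the existential one in \<open>Ck_on\<close>; it is
  taken at a full neighbourhood, so the two agree on open sets. The direction is an argument so that
  space derivatives, time derivatives and Hessians share one calculus.\<close>

definition pderiv_dir :: "'a::euclidean_space \<Rightarrow> ('a \<Rightarrow> real) \<Rightarrow> 'a \<Rightarrow> real" where
  "pderiv_dir v f x = frechet_derivative f (at x) v"

lemma pderiv_dir_eq: "(f has_derivative f') (at x) \<Longrightarrow> pderiv_dir v f x = f' v"
  unfolding pderiv_dir_def using frechet_derivative_at by metis

lemma has_derivative_pderiv_dir:
  assumes "Ck_on (Suc k) f S" "open S" "x \<in> S"
  shows "(f has_derivative (\<lambda>v. pderiv_dir v f x)) (at x)"
proof -
  have "f differentiable (at x)"
    using assms unfolding Ck_on.simps differentiable_def by (metis at_within_open)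
  then show ?thesis unfolding pderiv_dir_def by (simp add: frechet_derivative_works)
qed

lemma Ck_on_pderiv_dir:
  assumes "Ck_on (Suc k) f S" "open S"
  shows "Ck_on k (pderiv_dir v f) S"
proof -
  obtain f' where f': "\<forall>x\<in>S. (f has_derivative f' x) (at x within S)" "\<forall>v. Ck_on k (\<lambda>x. f' x v) S"
    using assms(1) by auto
  then have "Ck_on k (pderiv_dir v f) S \<longleftrightarrow> Ck_on k (\<lambda>x. f' x v) S"
    by (intro Ck_on_cong pderiv_dir_eq) (metis assms(2) at_within_open)
  with f' show ?thesis by blast
qed

lemma has_real_derivative_line:
  assumes "Ck_on (Suc k) f S" "open S" "x + s *\<^sub>R v \<in> S"
  shows "((\<lambda>s. f (x + s *\<^sub>R v)) has_real_derivative pderiv_dir v f (x + s *\<^sub>R v)) (at s)"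
proof -
  note d = has_derivative_pderiv_dir[OF assms]
  have "((\<lambda>s. f (x + s *\<^sub>R v)) has_derivative (\<lambda>h. pderiv_dir (h *\<^sub>R v) f (x + s *\<^sub>R v))) (at s)"
    by (rule has_derivative_compose[of "\<lambda>s. x + s *\<^sub>R v" "\<lambda>h. h *\<^sub>R v" s UNIV f, OF _ d])
      (auto intro!: derivative_eq_intros)
  moreover have "pderiv_dir (h *\<^sub>R v) f (x + s *\<^sub>R v) = pderiv_dir v f (x + s *\<^sub>R v) * h" for h
    using linear_cmul[OF has_derivative_linear[OF d], of h v] by simp
  ultimately show ?thesis by (simp add: has_field_derivative_def)
qed

text \<open>The mean value theorem is used twice: in direction \<open>a\<close> on the increment of
  \<open>f\<close> along \<open>h b\<close>, then in direction \<open>b\<close> on the resulting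
  increment of the derivative.\<close>

lemma mixed_difference_quotient:
  assumes f: "Ck_on (Suc (Suc 0)) f S" and "open S" and h: "h > 0"
    and sub: "\<And>r s. 0 \<le> r \<Longrightarrow> r \<le> h \<Longrightarrow> 0 \<le> s \<Longrightarrow> s \<le> h \<Longrightarrow> x + r *\<^sub>R a + s *\<^sub>R b \<in> S"
  shows "\<exists>r s. 0 \<le> r \<and> r \<le> h \<and> 0 \<le> s \<and> s \<le> h \<and>
    f (x + h *\<^sub>R a + h *\<^sub>R b) - f (x + h *\<^sub>R a) - f (x + h *\<^sub>R b) + f x
      = h\<^sup>2 * pderiv_dir b (pderiv_dir a f) (x + r *\<^sub>R a + s *\<^sub>R b)"
proof -
  let ?G = "\<lambda>r. f ((x + h *\<^sub>R b) + r *\<^sub>R a) - f (x + r *\<^sub>R a)"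
  have "\<exists>r>0. r < h \<and> ?G h - ?G 0 =
      (h - 0) * (pderiv_dir a f ((x + h *\<^sub>R b) + r *\<^sub>R a) - pderiv_dir a f (x + r *\<^sub>R a))"
  proof (rule MVT2[OF h])
    fix r assume "0 \<le> r" "r \<le> h"
    then have "(x + h *\<^sub>R b) + r *\<^sub>R a \<in> S" "x + r *\<^sub>R a \<in> S"
      using sub[of r h] sub[of r 0] h by (auto simp: algebra_simps)
    then show "(?G has_real_derivative
        (pderiv_dir a f ((x + h *\<^sub>R b) + r *\<^sub>R a) - pderiv_dir a f (x + r *\<^sub>R a))) (at r)"
      using f \<open>open S\<close> by (intro DERIV_diff has_real_derivative_line)
  qed
  then obtain r where r: "0 < r" "r < h" and eq1: "?G h - ?G 0 =
      h * (pderiv_dir a f ((x + h *\<^sub>R b) + r *\<^sub>R a) - pderiv_dir a f (x + r *\<^sub>R a))"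
    by auto
  have "\<exists>s>0. s < h \<and> pderiv_dir a f ((x + r *\<^sub>R a) + h *\<^sub>R b) - pderiv_dir a f ((x + r *\<^sub>R a) + 0 *\<^sub>R b) =
      (h - 0) * pderiv_dir b (pderiv_dir a f) ((x + r *\<^sub>R a) + s *\<^sub>R b)"
    using r sub[of r] \<open>open S\<close>
    by (intro MVT2[OF h] has_real_derivative_line[OF Ck_on_pderiv_dir[OF f]]) auto
  then obtain s where s: "0 < s" "s < h" "pderiv_dir a f ((x + r *\<^sub>R a) + h *\<^sub>R b) - pderiv_dir a f (x + r *\<^sub>R a) =
      h * pderiv_dir b (pderiv_dir a f) ((x + r *\<^sub>R a) + s *\<^sub>R b)"
    by auto
  have "?G h - ?G 0 = h * (h * pderiv_dir b (pderiv_dir a f) ((x + r *\<^sub>R a) + s *\<^sub>R b))"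
    unfolding eq1 s(3)[symmetric] by (simp add: add_ac)
  then show ?thesis using r s
    by (intro exI[of _ r] exI[of _ s]) (auto simp: power2_eq_square algebra_simps)
qed

text \<open>The second difference over a parallelogram is symmetric in \<open>a\<close> and
  \<open>b\<close>, so both mixed derivatives take a common value at points arbitrarily close to
  \<open>x\<close>; continuity forces them to agree at \<open>x\<close>.\<close>

lemma pderiv_dir_commute:
  assumes f: "Ck_on (Suc (Suc 0)) f S" and "open S" and "x \<in> S"
  shows "pderiv_dir a (pderiv_dir b f) x = pderiv_dir b (pderiv_dir a f) x"
proof (rule ccontr)
  let ?p = "pderiv_dir a (pderiv_dir b f)" and ?q = "pderiv_dir b (pderiv_dir a f)"
  assume "?p x \<noteq> ?q x"
  \<comment> \<open>Half of the supposed gap: the common value within \<open>e\<close> of both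
    derivatives would put them strictly less than \<open>2 * e\<close> apart.\<close>
  define e where "e = \<bar>?p x - ?q x\<bar> / 2"
  have e: "e > 0" using \<open>?p x \<noteq> ?q x\<close> by (simp add: e_def)
  have "continuous_on S ?p" "continuous_on S ?q"
    by (rule Ck_on_imp_continuous_on[OF Ck_on_pderiv_dir[OF Ck_on_pderiv_dir[OF f \<open>open S\<close>] \<open>open S\<close>]])+
  then have "isCont ?p x" "isCont ?q x"
    using \<open>open S\<close> \<open>x \<in> S\<close> by (auto simp: continuous_on_eq_continuous_at)
  then have "\<exists>d>0. \<forall>y. dist y x < d \<longrightarrow> dist (?p y) (?p x) < e" "\<exists>d>0. \<forall>y. dist y x < d \<longrightarrow> dist (?q y) (?q x) < e"
    using e unfolding continuous_at_eps_delta by blast+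
  then obtain d1 d2 where d: "d1 > 0" "d2 > 0"
      "\<And>y. dist y x < d1 \<Longrightarrow> dist (?p y) (?p x) < e" "\<And>y. dist y x < d2 \<Longrightarrow> dist (?q y) (?q x) < e"
    by blast
  obtain d3 where d3: "d3 > 0" "ball x d3 \<subseteq> S" using \<open>open S\<close> \<open>x \<in> S\<close> openE by blast
  define d where "d = Min {d1, d2, d3}"
  have dpos: "d > 0" using d d3 by (simp add: d_def)
  \<comment> \<open>The parallelogram with sides \<open>h a\<close>, \<open>h b\<close> stays within
    \<open>h * N\<close> of \<open>x\<close>; the summand 1 keeps \<open>N\<close> positive when
    both directions vanish.\<close>
  define N where "N = norm a + norm b + 1"
  define h where "h = d / (2 * N)"
  have "0 < N" by (simp add: N_def add_nonneg_pos)
  then have h: "h > 0" "h * N < d"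
    using dpos by (simp_all add: h_def)
  have near: "dist (x + r *\<^sub>R a + s *\<^sub>R b) x < d" if "0 \<le> r" "r \<le> h" "0 \<le> s" "s \<le> h" for r s
  proof -
    have "dist (x + r *\<^sub>R a + s *\<^sub>R b) x \<le> r * norm a + s * norm b"
      using that norm_triangle_ineq[of "r *\<^sub>R a" "s *\<^sub>R b"] by (simp add: dist_norm add.assoc)
    also have "\<dots> \<le> h * norm a + h * norm b" using that by (intro add_mono mult_right_mono) auto
    also have "\<dots> \<le> h * N" using h by (simp add: N_def algebra_simps)
    finally show ?thesis using h by simp
  qed
  have sub: "x + r *\<^sub>R a + s *\<^sub>R b \<in> S" "x + s *\<^sub>R b + r *\<^sub>R a \<in> S"
    if "0 \<le> r" "r \<le> h" "0 \<le> s" "s \<le> h" for r s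
    using near[OF that] d3 by (auto simp: d_def dist_commute add_ac)
  obtain r s where rs: "0 \<le> r" "r \<le> h" "0 \<le> s" "s \<le> h"
    "f (x + h *\<^sub>R a + h *\<^sub>R b) - f (x + h *\<^sub>R a) - f (x + h *\<^sub>R b) + f x = h\<^sup>2 * ?q (x + r *\<^sub>R a + s *\<^sub>R b)"
    using mixed_difference_quotient[OF f \<open>open S\<close> h(1) sub(1)] by blast
  obtain r' s' where rs': "0 \<le> r'" "r' \<le> h" "0 \<le> s'" "s' \<le> h"
    "f (x + h *\<^sub>R b + h *\<^sub>R a) - f (x + h *\<^sub>R b) - f (x + h *\<^sub>R a) + f x = h\<^sup>2 * ?p (x + r' *\<^sub>R b + s' *\<^sub>R a)"
    using mixed_difference_quotient[OF f \<open>open S\<close> h(1) sub(2)] by blast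
  have "h\<^sup>2 * ?q (x + r *\<^sub>R a + s *\<^sub>R b) = h\<^sup>2 * ?p (x + r' *\<^sub>R b + s' *\<^sub>R a)"
    unfolding rs(5)[symmetric] rs'(5)[symmetric] by (simp add: add_ac)
  then have "?q (x + r *\<^sub>R a + s *\<^sub>R b) = ?p (x + r' *\<^sub>R b + s' *\<^sub>R a)" using h by simp
  moreover have "dist (?q (x + r *\<^sub>R a + s *\<^sub>R b)) (?q x) < e"
    using near[of r s] rs d(4) by (simp add: d_def)
  moreover have "dist (?p (x + r' *\<^sub>R b + s' *\<^sub>R a)) (?p x) < e"
    using near[of s' r'] rs' d(3) by (simp add: d_def add_ac)
  moreover have "dist (?q x) (?p x) = 2 * e" by (simp add: e_def dist_real_def)
  ultimately show False
    using dist_triangle3[of "?q x" "?p x" "?q (x + r *\<^sub>R a + s *\<^sub>R b)"] by simp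
qed

section \<open>Positive semidefinite matrices and Hessians\<close>

text \<open>A Cholesky factorization; it avoids square roots of matrices in the trace inequality below.\<close>

lemma psd_kernel_factorization:
  fixes A :: "'i \<Rightarrow> 'i \<Rightarrow> real"
  assumes "finite I" and "\<And>i j. i \<in> I \<Longrightarrow> j \<in> I \<Longrightarrow> A i j = A j i"
    and "\<And>x. 0 \<le> (\<Sum>i\<in>I. \<Sum>j\<in>I. x i * A i j * x j)"
  shows "\<exists>c. \<forall>i\<in>I. \<forall>j\<in>I. A i j = (\<Sum>r\<in>I. c r i * c r j)"
  using assms
proof (induction I arbitrary: A rule: finite_induct)
  case (insert k J)
  have expand: "0 \<le> y\<^sup>2 * A k k + 2 * y * (\<Sum>j\<in>J. A k j * x j) + (\<Sum>i\<in>J. \<Sum>j\<in>J. x i * A i j * x j)" for x y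
  proof -
    let ?x = "x(k := y)"
    have nk: "j \<noteq> k" if "j \<in> J" for j using that insert.hyps by auto
    have "0 \<le> (\<Sum>i\<in>insert k J. \<Sum>j\<in>insert k J. ?x i * A i j * ?x j)" by (rule insert.prems)
    also have "\<dots> = y * A k k * y + (\<Sum>j\<in>J. y * A k j * x j)
        + ((\<Sum>i\<in>J. x i * A i k * y) + (\<Sum>i\<in>J. \<Sum>j\<in>J. x i * A i j * x j))"
      using insert.hyps nk by (simp add: sum.distrib cong: sum.cong)
    also have "(\<Sum>i\<in>J. x i * A i k * y) = (\<Sum>j\<in>J. y * A k j * x j)"
      using insert.prems(1) by (intro sum.cong) (auto simp: mult_ac)
    finally show ?thesis by (simp add: sum_distrib_left power2_eq_square algebra_simps)
  qed
  have a: "A k k \<ge> 0" using expand[of 1 "\<lambda>_. 0"] by simp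
  have zero: "A k j = 0" if "A k k = 0" "j \<in> J" for j
  proof (rule ccontr)
    assume nz: "A k j \<noteq> 0"
    \<comment> \<open>With pivot 0, the form at \<open>y\<close> in coordinate \<open>k\<close> and
      1 in coordinate \<open>j\<close> is \<open>2 * y * A k j + A j j\<close>, affine in
      \<open>y\<close>; the \<open>y\<close> chosen below gives it the value -1.\<close>
    let ?x = "\<lambda>i. if i = j then 1 else 0 :: real"
    have "(\<Sum>i\<in>J. A k i * ?x i) = A k j" "(\<Sum>i\<in>J. \<Sum>l\<in>J. ?x i * A i l * ?x l) = A j j"
      using that insert.hyps by (simp_all add: if_distrib[of "\<lambda>y. y * _"] if_distrib[of "\<lambda>y. _ * y"] cong: if_cong)
    then show False using expand[of "- (A j j + 1) / (2 * A k j)" ?x] that nz by (simp add: field_simps)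
  qed
  \<comment> \<open>The first Cholesky row. A zero pivot forces its whole row to vanish, so the zero
    vector serves there. Subtracting \<open>c0 i * c0 j\<close> leaves the Schur complement, to
    which the induction hypothesis applies.\<close>
  define c0 where "c0 j = (if A k k = 0 then 0 else A k j / sqrt (A k k))" for j
  have c0: "c0 k * c0 j = A k j" if "j \<in> insert k J" for j
    using that zero a by (auto simp: c0_def)
  have "\<exists>c. \<forall>i\<in>J. \<forall>j\<in>J. A i j - c0 i * c0 j = (\<Sum>r\<in>J. c r i * c r j)"
  proof (rule insert.IH)
    fix i j assume "i \<in> J" "j \<in> J"
    then show "A i j - c0 i * c0 j = A j i - c0 j * c0 i" using insert.prems(1) by simp
  next
    fix x
    let ?b = "\<Sum>j\<in>J. A k j * x j"
    have "(\<Sum>i\<in>J. \<Sum>j\<in>J. x i * (A i j - c0 i * c0 j) * x j)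
      = (\<Sum>i\<in>J. \<Sum>j\<in>J. x i * A i j * x j) - (\<Sum>j\<in>J. c0 j * x j)\<^sup>2"
      by (simp add: power2_eq_square sum_product sum_subtractf[symmetric] algebra_simps)
    moreover have "(\<Sum>j\<in>J. c0 j * x j)\<^sup>2 = (if A k k = 0 then 0 else ?b\<^sup>2 / A k k)"
      using a by (simp add: c0_def sum_divide_distrib[symmetric] power_divide)
    \<comment> \<open>For a positive pivot, \<open>y = - ?b / A k k\<close> minimizes the quadratic
      polynomial in \<open>expand\<close>, and its minimum is the form of the Schur
      complement.\<close>
    moreover have "(if A k k = 0 then 0 else ?b\<^sup>2 / A k k) \<le> (\<Sum>i\<in>J. \<Sum>j\<in>J. x i * A i j * x j)"
      using expand[of 0 x] expand[of "- ?b / A k k" x] a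
      by (auto simp: power2_eq_square)
    ultimately show "0 \<le> (\<Sum>i\<in>J. \<Sum>j\<in>J. x i * (A i j - c0 i * c0 j) * x j)" by simp
  qed
  then obtain c where c: "\<And>i j. i \<in> J \<Longrightarrow> j \<in> J \<Longrightarrow> A i j - c0 i * c0 j = (\<Sum>r\<in>J. c r i * c r j)"
    by blast
  let ?c = "\<lambda>r i. if r = k then c0 i else if i = k then 0 else c r i"
  have "A i j = (\<Sum>r\<in>insert k J. ?c r i * ?c r j)" if ij: "i \<in> insert k J" "j \<in> insert k J" for i j
  proof -
    have "(\<Sum>r\<in>insert k J. ?c r i * ?c r j) = c0 i * c0 j + (\<Sum>r\<in>J. ?c r i * ?c r j)"
      using insert.hyps by simp
    also have "(\<Sum>r\<in>J. ?c r i * ?c r j) = (if i = k \<or> j = k then 0 else (\<Sum>r\<in>J. c r i * c r j))"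
      using insert.hyps by (auto intro!: sum.neutral sum.cong)
    also have "c0 i * c0 j + \<dots> = A i j"
    proof (cases "i = k \<or> j = k")
      case True
      then show ?thesis
        using ij c0[of i] c0[of j] insert.prems(1)[of i j] by (auto simp: mult.commute[of "c0 i" "c0 k"])
    next
      case False
      then have "A i j - c0 i * c0 j = (\<Sum>r\<in>J. c r i * c r j)" using ij False by (intro c) auto
      moreover have "(if i = k \<or> j = k then 0 else z) = z" for z :: real using False by simp
      ultimately show ?thesis by simp
    qed
    finally show ?thesis by simp
  qed
  then show ?case by (intro exI[of _ ?c] ballI)
qed simp

text \<open>With A = C^T C, the trace of ABAB equals that of (C B C^T)^2. Here \<open>e\<close> is C
  B and \<open>G\<close> is C B C^T, which inherits symmetry from \<open>B\<close>, so the trace is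
  a sum of squares.\<close>

lemma trace_psd_symmetric_square_nonneg:
  fixes A B :: "'i::finite \<Rightarrow> 'i \<Rightarrow> real"
  assumes "\<And>i j. A i j = A j i" and "\<And>x. 0 \<le> (\<Sum>i\<in>UNIV. \<Sum>j\<in>UNIV. x i * A i j * x j)"
    and B: "\<And>i j. B i j = B j i"
  shows "0 \<le> (\<Sum>i\<in>UNIV. \<Sum>k\<in>UNIV. (\<Sum>j\<in>UNIV. A i j * B j k) * (\<Sum>j\<in>UNIV. A k j * B j i))"
proof -
  obtain c :: "'i \<Rightarrow> 'i \<Rightarrow> real" where "\<forall>i\<in>UNIV. \<forall>j\<in>UNIV. A i j = (\<Sum>r\<in>UNIV. c r i * c r j)"
    using psd_kernel_factorization[of UNIV A, OF finite assms(1,2)] by blast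
  then have c: "A i j = (\<Sum>r\<in>UNIV. c r i * c r j)" for i j by blast
  define e where "e r k = (\<Sum>j\<in>UNIV. c r j * B j k)" for r k
  define G where "G r s = (\<Sum>i\<in>UNIV. c r i * e s i)" for r s
  have G: "G r s = G s r" for r s
  proof -
    have "G r s = (\<Sum>i\<in>UNIV. \<Sum>j\<in>UNIV. c r i * (c s j * B j i))"
      by (simp add: G_def e_def sum_distrib_left)
    also have "\<dots> = (\<Sum>j\<in>UNIV. \<Sum>i\<in>UNIV. c s j * (c r i * B i j))"
      by (subst sum.swap) (simp add: B mult_ac)
    finally show ?thesis by (simp add: G_def e_def sum_distrib_left)
  qed
  have AB: "(\<Sum>j\<in>UNIV. A i j * B j k) = (\<Sum>r\<in>UNIV. c r i * e r k)" for i k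
    unfolding c e_def sum_distrib_left sum_distrib_right
    by (subst sum.swap) (simp add: mult_ac)
  \<comment> \<open>The factors are regrouped so that one depends on \<open>i\<close> and the other
    on \<open>k\<close>; once \<open>r\<close> and \<open>s\<close> are summed outermost, the two
    inner sums separate into \<open>G r s\<close> and \<open>G s r\<close>.\<close>
  have "(\<Sum>i\<in>UNIV. \<Sum>k\<in>UNIV. (\<Sum>j\<in>UNIV. A i j * B j k) * (\<Sum>j\<in>UNIV. A k j * B j i))
    = (\<Sum>i\<in>UNIV. \<Sum>k\<in>UNIV. \<Sum>r\<in>UNIV. \<Sum>s\<in>UNIV. (c r i * e s i) * (c s k * e r k))"
    unfolding AB sum_product by (simp add: mult_ac)
  also have "\<dots> = (\<Sum>i\<in>UNIV. \<Sum>r\<in>UNIV. \<Sum>k\<in>UNIV. \<Sum>s\<in>UNIV. (c r i * e s i) * (c s k * e r k))"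
    by (intro sum.cong refl sum.swap)
  also have "\<dots> = (\<Sum>r\<in>UNIV. \<Sum>i\<in>UNIV. \<Sum>s\<in>UNIV. \<Sum>k\<in>UNIV. (c r i * e s i) * (c s k * e r k))"
    by (subst sum.swap) (intro sum.cong refl sum.swap)
  also have "\<dots> = (\<Sum>r\<in>UNIV. \<Sum>s\<in>UNIV. \<Sum>i\<in>UNIV. \<Sum>k\<in>UNIV. (c r i * e s i) * (c s k * e r k))"
    by (intro sum.cong refl sum.swap)
  also have "\<dots> = (\<Sum>r\<in>UNIV. \<Sum>s\<in>UNIV. G r s * G s r)"
    unfolding G_def sum_product ..
  also have "\<dots> \<ge> 0"
    using G by (intro sum_nonneg) (metis zero_le_square)
  finally show ?thesis .
qed

lemma pderiv_dir_sum_axis: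
  fixes f :: "real^'n \<Rightarrow> real"
  assumes "(f has_derivative (\<lambda>v. pderiv_dir v f p)) (at p)"
  shows "pderiv_dir x f p = (\<Sum>i\<in>UNIV. x $ i * pderiv_dir (axis i 1) f p)"
proof -
  have l: "linear (\<lambda>v. pderiv_dir v f p)" using assms has_derivative_linear by blast
  have "x = (\<Sum>i\<in>UNIV. x $ i *\<^sub>R axis i 1)"
    by (simp add: vec_eq_iff axis_def if_distrib cong: if_cong)
  then have "pderiv_dir x f p = pderiv_dir (\<Sum>i\<in>UNIV. x $ i *\<^sub>R axis i 1) f p" by simp
  also have "\<dots> = (\<Sum>i\<in>UNIV. x $ i * pderiv_dir (axis i 1) f p)"
    using linear_sum[OF l, of "\<lambda>i. x $ i *\<^sub>R axis i 1" UNIV] linear_cmul[OF l] by simp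
  finally show ?thesis .
qed

text \<open>Add the tangent inequalities at \<open>a\<close> and at \<open>b\<close>.\<close>

lemma convex_on_deriv_mono:
  fixes h :: "real \<Rightarrow> real"
  assumes "convex_on UNIV h" "\<And>s. (h has_real_derivative h' s) (at s)"
  shows "mono h'"
proof (rule monoI)
  fix a b :: real assume ab: "a \<le> b"
  have t: "h' c * (x - c) \<le> h x - h c" for c x
    using convex_on_imp_above_tangent[OF assms(1), of c x "h' c"] assms(2) by simp
  show "h' a \<le> h' b"
  proof (cases "a = b")
    case False
    have "(h' a - h' b) * (b - a) \<le> 0" using t[of a b] t[of b a] by (simp add: algebra_simps)
    with False ab show ?thesis by (simp add: mult_le_0_iff)
  qed simp
qed

text \<open>The quadratic form is the second derivative at 0 of \<open>H\<close> along a line; there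
  \<open>H\<close> is convex, so its first derivative is monotone.\<close>

lemma convex_on_hessian_nonneg:
  fixes H :: "real^'n \<Rightarrow> real"
  assumes H: "Ck_on (Suc (Suc 0)) H UNIV" and convex: "convex_on UNIV H"
  shows "0 \<le> (\<Sum>i\<in>UNIV. \<Sum>j\<in>UNIV. x i * pderiv_dir (axis i 1) (pderiv_dir (axis j 1) H) p * x j)"
proof -
  let ?x = "\<chi> i. x i"
  let ?h = "\<lambda>s. H (p + s *\<^sub>R ?x)" and ?h' = "\<lambda>s. \<Sum>j\<in>UNIV. x j * pderiv_dir (axis j 1) H (p + s *\<^sub>R ?x)"
  note H1 = Ck_on_pderiv_dir[OF H open_UNIV]
  have "convex_on UNIV ?h"
  proof (rule convex_onI)
    fix t a b :: real assume "0 < t" "t < 1"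
    moreover have "p + ((1 - t) *\<^sub>R a + t *\<^sub>R b) *\<^sub>R ?x = (1 - t) *\<^sub>R (p + a *\<^sub>R ?x) + t *\<^sub>R (p + b *\<^sub>R ?x)"
      by (simp add: algebra_simps)
    ultimately show "?h ((1 - t) *\<^sub>R a + t *\<^sub>R b) \<le> (1 - t) * ?h a + t * ?h b"
      using convex_onD[OF convex, of t] by simp
  qed simp
  moreover have "(?h has_real_derivative ?h' s) (at s)" for s
    using has_real_derivative_line[OF H open_UNIV UNIV_I, of p ?x s]
      pderiv_dir_sum_axis[OF has_derivative_pderiv_dir[OF H open_UNIV UNIV_I], where x = ?x] by simp
  ultimately have "mono ?h'" by (rule convex_on_deriv_mono)
  then have "mono_on UNIV ?h'" by simp
  moreover have "(?h' has_real_derivative (\<Sum>j\<in>UNIV. x j * pderiv_dir ?x (pderiv_dir (axis j 1) H) (p + 0 *\<^sub>R ?x))) (at 0)"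
    by (intro DERIV_sum DERIV_cmult has_real_derivative_line[OF H1]) simp_all
  ultimately have "0 \<le> (\<Sum>j\<in>UNIV. x j * pderiv_dir ?x (pderiv_dir (axis j 1) H) (p + 0 *\<^sub>R ?x))"
    by (rule mono_on_imp_deriv_nonneg) simp
  also have "\<dots> = (\<Sum>j\<in>UNIV. \<Sum>i\<in>UNIV. x i * pderiv_dir (axis i 1) (pderiv_dir (axis j 1) H) p * x j)"
    by (subst pderiv_dir_sum_axis[OF has_derivative_pderiv_dir[OF H1]])
      (simp_all add: sum_distrib_left mult_ac)
  finally show ?thesis by (subst sum.swap)
qed

section \<open>Periodic functions in space-time\<close>

text \<open>The translated cube is cut along x_i = 1; the protruding slab, moved back by one period,
  fills the gap 0 <= x_i <= s left in the unit cube.\<close>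

lemma integral_unit_cube_shift:
  fixes f :: "real^'n \<Rightarrow> real"
  assumes cont: "continuous_on UNIV f" and per: "\<And>x. f (x + axis i 1) = f x" and s: "0 \<le> s" "s \<le> 1"
  shows "integral (cbox 0 1) (\<lambda>x. f (x + s *\<^sub>R axis i 1)) = integral (cbox 0 1) f"
proof -
  let ?e = "axis i 1 :: real^'n"
  have e: "?e \<in> Basis" by simp
  have mem: "x \<in> cbox (a *\<^sub>R ?e) (1 + b *\<^sub>R ?e) \<longleftrightarrow>
      a \<le> x $ i \<and> x $ i \<le> 1 + b \<and> (\<forall>j. j \<noteq> i \<longrightarrow> 0 \<le> x $ j \<and> x $ j \<le> 1)" for x a b
    by (auto simp: mem_box_cart axis_def)
  have int: "f integrable_on cbox a b" for a b
    by (rule integrable_continuous[OF continuous_on_subset[OF cont]]) simp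
  have "integral (cbox 0 1) (\<lambda>x. f (x + s *\<^sub>R ?e)) = integral (cbox 0 1) (f \<circ> (+) (s *\<^sub>R ?e))"
    by (simp add: o_def add.commute)
  also have "\<dots> = integral (cbox (s *\<^sub>R ?e) (1 + s *\<^sub>R ?e)) f"
    by (subst integral_shift_cbox_plus) simp
  also have "\<dots> = integral (cbox (s *\<^sub>R ?e) (1 + s *\<^sub>R ?e) \<inter> {x. x \<bullet> ?e \<le> 1}) f
      + integral (cbox (s *\<^sub>R ?e) (1 + s *\<^sub>R ?e) \<inter> {x. x \<bullet> ?e \<ge> 1}) f"
    by (rule integral_split[OF int e])
  also have "cbox (s *\<^sub>R ?e) (1 + s *\<^sub>R ?e) \<inter> {x. x \<bullet> ?e \<le> 1} = cbox 0 1 \<inter> {x. x \<bullet> ?e \<ge> s}"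
    using s mem[of _ s s] mem[of _ 0 0] by (auto simp: inner_axis)
  also have "cbox (s *\<^sub>R ?e) (1 + s *\<^sub>R ?e) \<inter> {x. x \<bullet> ?e \<ge> 1} = cbox (0 + ?e) ((1 + (s - 1) *\<^sub>R ?e) + ?e)"
    using s mem[of _ s s] mem[of _ 1 s] by (auto simp: inner_axis algebra_simps)
  also have "integral \<dots> f = integral (cbox 0 (1 + (s - 1) *\<^sub>R ?e)) (f \<circ> (+) ?e)"
    by (rule integral_shift_cbox_plus[symmetric])
  also have "f \<circ> (+) ?e = f" using per by (simp add: o_def add.commute)
  also have "cbox 0 (1 + (s - 1) *\<^sub>R ?e) = cbox 0 1 \<inter> {x. x \<bullet> ?e \<le> s}"
    using s mem[of _ 0 0] mem[of _ 0 "s - 1"] by (auto simp: inner_axis)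
  finally show ?thesis using integral_split[OF int e, of 0 1 s] by simp
qed

abbreviation dx :: "'n::finite \<Rightarrow> ((real^'n) \<times> real \<Rightarrow> real) \<Rightarrow> (real^'n) \<times> real \<Rightarrow> real" where
  "dx i \<equiv> pderiv_dir (axis i 1, 0)"

abbreviation dt :: "((real^'n) \<times> real \<Rightarrow> real) \<Rightarrow> (real^'n) \<times> real \<Rightarrow> real" where
  "dt \<equiv> pderiv_dir (0, 1)"

text \<open>Invariance under the generators of the lattice; \<open>J\<close> is there because
  nothing is known about the functions at times outside the given interval.\<close>

definition space_periodic :: "real set \<Rightarrow> ((real^'n) \<times> real \<Rightarrow> 'b) \<Rightarrow> bool" where
  "space_periodic J f \<longleftrightarrow> (\<forall>x. \<forall>t\<in>J. \<forall>i. f (x + axis i 1, t) = f (x, t))"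

lemma space_periodic_pderiv_dir:
  fixes f :: "(real^'n) \<times> real \<Rightarrow> real"
  assumes per: "space_periodic J f" and f: "Ck_on (Suc k) f (UNIV \<times> J)" and J: "open J"
  shows "space_periodic J (pderiv_dir v f)"
  unfolding space_periodic_def
proof (intro allI ballI)
  fix x :: "real^'n" and t i assume t: "t \<in> J"
  have op: "open ((UNIV :: (real^'n) set) \<times> J)" using J by (intro open_Times) auto
  let ?s = "\<lambda>z :: (real^'n) \<times> real. z + (axis i 1, 0)"
  have "(f has_derivative (\<lambda>v. pderiv_dir v f (x + axis i 1, t))) (at (?s (x, t)))"
    using has_derivative_pderiv_dir[OF f op, of "(x + axis i 1, t)"] t by simp
  then have "((\<lambda>z. f (?s z)) has_derivative (\<lambda>v. pderiv_dir v f (x + axis i 1, t))) (at (x, t))"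
    by (intro has_derivative_compose[of ?s "\<lambda>h. h" "(x, t)" UNIV f]) (auto intro!: derivative_eq_intros)
  then have "(f has_derivative (\<lambda>v. pderiv_dir v f (x + axis i 1, t))) (at (x, t))"
    by (rule has_derivative_transform_within_open[OF _ op])
      (use t per in \<open>auto simp: space_periodic_def\<close>)
  then show "pderiv_dir v f (x + axis i 1, t) = pderiv_dir v f (x, t)"
    by (metis pderiv_dir_eq)
qed

text \<open>This replaces the divergence theorem. The integral over the cube of the translate by
  \<open>s\<close> does not depend on \<open>s\<close>; differentiating under the integral at
  \<open>s = 0\<close> gives the integral of the partial derivative.\<close>

lemma integral_dx_eq_0:
  fixes F :: "(real^'n) \<times> real \<Rightarrow> real"
  assumes F: "Ck_on (Suc k) F (UNIV \<times> J)" and per: "space_periodic J F" and J: "open J" and t: "t \<in> J"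
  shows "integral (cbox 0 1) (\<lambda>x. dx i F (x, t)) = 0"
proof -
  let ?e = "axis i 1 :: real^'n"
  have op: "open ((UNIV :: (real^'n) set) \<times> J)" using J by (intro open_Times) auto
  have cont: "continuous_on (UNIV \<times> J) F" "continuous_on (UNIV \<times> J) (dx i F)"
    using F Ck_on_pderiv_dir[OF F op] Ck_on_imp_continuous_on by blast+
  let ?I = "\<lambda>s. integral (cbox 0 1) (\<lambda>x. F (x + s *\<^sub>R ?e, t))"
  have "(?I has_real_derivative integral (cbox 0 1) (\<lambda>x. dx i F (x + 0 *\<^sub>R ?e, t))) (at 0 within {0..1})"
  proof (rule leibniz_rule_field_derivative[where fx = "\<lambda>s x. dx i F (x + s *\<^sub>R ?e, t)"])
    fix s :: real and x :: "real^'n"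
    have "((\<lambda>s. F ((x, t) + s *\<^sub>R (?e, 0))) has_real_derivative dx i F ((x, t) + s *\<^sub>R (?e, 0))) (at s)"
      using t by (intro has_real_derivative_line[OF F op]) simp
    then show "((\<lambda>s. F (x + s *\<^sub>R ?e, t)) has_real_derivative dx i F (x + s *\<^sub>R ?e, t)) (at s within {0..1})"
      by (simp add: has_field_derivative_at_within)
  next
    fix s :: real
    show "(\<lambda>x. F (x + s *\<^sub>R ?e, t)) integrable_on cbox 0 1"
      using t by (intro integrable_continuous continuous_on_compose2[OF cont(1)] continuous_intros) auto
  next
    show "continuous_on ({0..1} \<times> cbox 0 1) (\<lambda>(s, x). dx i F (x + s *\<^sub>R ?e, t))"
      unfolding case_prod_beta using t
      by (intro continuous_on_compose2[OF cont(2)] continuous_intros) auto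
  qed auto
  moreover have "?I s = integral (cbox 0 1) (\<lambda>x. F (x, t))" if "s \<in> {0..1}" for s
    using that t per
    by (intro integral_unit_cube_shift continuous_on_compose2[OF cont(1)] continuous_intros)
      (auto simp: space_periodic_def)
  then have "(?I has_real_derivative 0) (at 0 within {0..1})"
    by (intro has_field_derivative_transform_within[OF DERIV_const zero_less_one]) auto
  moreover have "at (0::real) within {0..1} \<noteq> bot"
    by (simp add: at_within_Icc_at_right)
  ultimately have "integral (cbox 0 1) (\<lambda>x. dx i F (x + 0 *\<^sub>R ?e, t)) = 0"
    by (rule has_field_derivative_unique)
  then show ?thesis by simp
qed

lemma has_real_derivative_integral_dt:
  fixes F :: "(real^'n) \<times> real \<Rightarrow> real"
  assumes F: "Ck_on (Suc k) F (UNIV \<times> {a<..<b})" and t: "t \<in> {a<..<b}"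
  shows "((\<lambda>t. integral (cbox 0 1) (\<lambda>x. F (x, t))) has_real_derivative
    integral (cbox 0 1) (\<lambda>x. dt F (x, t))) (at t)"
proof -
  have op: "open ((UNIV :: (real^'n) set) \<times> {a<..<b})" by (intro open_Times) auto
  have cont: "continuous_on (UNIV \<times> {a<..<b}) F" "continuous_on (UNIV \<times> {a<..<b}) (dt F)"
    using F Ck_on_pderiv_dir[OF F op] Ck_on_imp_continuous_on by blast+
  have "((\<lambda>t. integral (cbox 0 1) (\<lambda>x. F (x, t))) has_real_derivative
    integral (cbox 0 1) (\<lambda>x. dt F (x, t))) (at t within {a<..<b})"
  proof (rule leibniz_rule_field_derivative[where fx = "\<lambda>s x. dt F (x, s)"])
    fix s :: real and x :: "real^'n" assume "s \<in> {a<..<b}"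
    then have "((\<lambda>s. F ((x, 0) + s *\<^sub>R (0, 1))) has_real_derivative dt F ((x, 0) + s *\<^sub>R (0, 1))) (at s)"
      by (intro has_real_derivative_line[OF F op]) simp
    then show "((\<lambda>s. F (x, s)) has_real_derivative dt F (x, s)) (at s within {a<..<b})"
      by (simp add: has_field_derivative_at_within)
  next
    fix s :: real assume "s \<in> {a<..<b}"
    then show "(\<lambda>x. F (x, s)) integrable_on cbox 0 1"
      by (intro integrable_continuous continuous_on_compose2[OF cont(1)] continuous_intros) auto
  next
    show "continuous_on ({a<..<b} \<times> cbox 0 1) (\<lambda>(s, x). dt F (x, s))"
      unfolding case_prod_beta
      by (intro continuous_on_compose2[OF cont(2)] continuous_intros) auto
  qed (use t in auto)
  then show ?thesis by (simp only: at_within_open[OF t open_greaterThanLessThan])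
qed

section \<open>Logarithmic convexity and \<open>L\<^sup>q\<close> norms\<close>

text \<open>Both limits of the interpolation argument below have this form: moving interior times to
  the end times, and removing the regularization.\<close>

lemma continuous_lower_bound_at_0:
  fixes K :: "real \<Rightarrow> real"
  assumes "continuous_on {0..1} K" "\<And>h. h \<in> {0<..<1} \<Longrightarrow> c \<le> K h"
  shows "c \<le> K 0"
  using continuous_ge_on_closure[of "{0<..<1}" K 0 c] assms by simp

text \<open>The hypothesis on \<open>\<phi>''\<close> is listed separately because
  \<open>log_convex\<close> says nothing about its sign where \<open>\<phi>\<close> vanishes, and
  that sign is what lets log-convexity pass to \<open>\<phi> + e\<close>.\<close>

lemma log_convex_interpolation:
  fixes \<phi> \<phi>' \<phi>'' :: "real \<Rightarrow> real"
  assumes T: "T > 0" and cont: "continuous_on {0..T} \<phi>" and nonneg: "\<And>t. t \<in> {0..T} \<Longrightarrow> 0 \<le> \<phi> t"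
    and d1: "\<And>t. t \<in> {0<..<T} \<Longrightarrow> (\<phi> has_real_derivative \<phi>' t) (at t)"
    and d2: "\<And>t. t \<in> {0<..<T} \<Longrightarrow> (\<phi>' has_real_derivative \<phi>'' t) (at t)"
    and d2_nonneg: "\<And>t. t \<in> {0<..<T} \<Longrightarrow> 0 \<le> \<phi>'' t"
    and log_convex: "\<And>t. t \<in> {0<..<T} \<Longrightarrow> (\<phi>' t)\<^sup>2 \<le> \<phi> t * \<phi>'' t"
    and t: "t \<in> {0<..<T}"
  shows "\<phi> t \<le> \<phi> 0 powr (1 - t / T) * \<phi> T powr (t / T)"
proof -
  define s where "s = t / T"
  have s: "0 < s" "s < 1" using t by (auto simp: s_def)
  have tT: "t = s * T" using T by (simp add: s_def)
  \<comment> \<open>\<open>\<phi>\<close> may vanish, so the logarithm is taken of \<open>\<phi> + e\<close>, for which the hypotheses persist.\<close>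
  have *: "\<phi> t + e \<le> (\<phi> 0 + e) powr (1 - s) * (\<phi> T + e) powr s" if e: "e > 0" for e
  proof -
    let ?L = "\<lambda>t. ln (\<phi> t + e)"
    have pos: "0 < \<phi> t + e" if "t \<in> {0..T}" for t using nonneg[OF that] e by simp
    have conv: "convex_on {0<..<T} ?L"
    proof (rule f''_ge0_imp_convex)
      fix x assume x: "x \<in> {0<..<T}"
      then have p: "0 < \<phi> x + e" using pos by simp
      show "(?L has_real_derivative \<phi>' x / (\<phi> x + e)) (at x)"
        using p by (auto intro!: derivative_eq_intros d1[OF x] simp: field_simps)
      show "((\<lambda>x. \<phi>' x / (\<phi> x + e)) has_real_derivative
          (\<phi>'' x * (\<phi> x + e) - \<phi>' x * \<phi>' x) / ((\<phi> x + e) * (\<phi> x + e))) (at x)"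
        using p by (auto intro!: derivative_eq_intros d1[OF x] d2[OF x])
      have "0 \<le> \<phi>'' x * (\<phi> x + e) - \<phi>' x * \<phi>' x"
        using log_convex[OF x] mult_nonneg_nonneg[OF d2_nonneg[OF x], of e] e
        by (simp add: power2_eq_square algebra_simps)
      then show "0 \<le> (\<phi>'' x * (\<phi> x + e) - \<phi>' x * \<phi>' x) / ((\<phi> x + e) * (\<phi> x + e))" by simp
    qed simp
    \<comment> \<open>The two interior times run to 0 and T as \<open>h\<close> tends to 0, while
      their average with weights \<open>1 - s\<close>, \<open>s\<close> remains \<open>t\<close>.
      Convexity on the open interval thus passes to the closed one.\<close>
    define K where "K h = (1 - s) * ?L (h * t) + s * ?L (T - h * (T - t))" for h
    have range: "h * t \<in> {0..T}" "T - h * (T - t) \<in> {0..T}" if "h \<in> {0..1}" for h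
    proof -
      define y z where "y = h * (T - t)" and "z = h * t"
      have "z \<le> t" "0 \<le> z" "y \<le> T - t" "0 \<le> y"
        using that t by (auto simp: y_def z_def intro!: mult_left_le_one_le)
      then show "h * t \<in> {0..T}" "T - h * (T - t) \<in> {0..T}"
        using t by (auto simp flip: y_def z_def)
    qed
    have "continuous_on {0..T} ?L"
      using pos by (intro continuous_intros cont) force
    note cL = continuous_on_compose2[OF this]
    have "continuous_on {0..1} (\<lambda>h. ?L (h * t))"
      by (rule cL[of _ "\<lambda>h. h * t"], intro continuous_intros, use range in blast)
    moreover have "continuous_on {0..1} (\<lambda>h. ?L (T - h * (T - t)))"
      by (rule cL[of _ "\<lambda>h. T - h * (T - t)"], intro continuous_intros, use range in blast)
    ultimately have "continuous_on {0..1} K"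
      unfolding K_def by (intro continuous_on_add continuous_on_mult continuous_on_const)
    moreover have "?L t \<le> K h" if h: "h \<in> {0<..<1}" for h
    proof -
      have "h * t < 1 * t" "h * (T - t) < 1 * (T - t)" "0 < h * t" "0 < h * (T - t)"
        using h t by (auto intro!: mult_strict_right_mono)
      then have "h * t \<in> {0<..<T}" "T - h * (T - t) \<in> {0<..<T}"
        using t by auto
      moreover have "(1 - s) *\<^sub>R (h * t) + s *\<^sub>R (T - h * (T - t)) = t"
        by (simp add: tT algebra_simps)
      ultimately show ?thesis
        using convex_onD[OF conv, of s "h * t" "T - h * (T - t)"] s by (simp add: K_def)
    qed
    ultimately have "?L t \<le> K 0"
      by (rule continuous_lower_bound_at_0)
    then have "exp (?L t) \<le> exp (K 0)" by simp
    moreover have "0 < \<phi> t + e" "0 < \<phi> 0 + e" "0 < \<phi> T + e"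
      using pos t T by auto
    then have "exp (?L t) = \<phi> t + e" "exp (K 0) = (\<phi> 0 + e) powr (1 - s) * (\<phi> T + e) powr s"
      by (simp_all add: K_def exp_add powr_def)
    ultimately show ?thesis by simp
  qed
  \<comment> \<open>Lets \<open>e\<close> tend to 0; both exponents are positive since
    \<open>t\<close> is interior, so \<open>powr\<close> is continuous even at base 0.\<close>
  define M where "M e = (\<phi> 0 + e) powr (1 - s) * (\<phi> T + e) powr s - (\<phi> t + e)" for e
  have "continuous_on {0..1} M"
    unfolding M_def using s nonneg[of 0] nonneg[of T] T
    by (intro continuous_intros continuous_on_powr') auto
  moreover have "0 \<le> M e" if "e \<in> {0<..<1}" for e
    using *[of e] that by (simp add: M_def)
  ultimately have "0 \<le> M 0"
    by (rule continuous_lower_bound_at_0)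
  then show ?thesis by (simp add: M_def s_def)
qed

section \<open>Norms on the unit cube and the passage to the supremum norm\<close>

lemma rpow_nonneg: "0 \<le> rpow a s"
  by (simp add: rpow_def)

lemma rpow_mono: "0 \<le> a \<Longrightarrow> a \<le> b \<Longrightarrow> 0 \<le> s \<Longrightarrow> rpow a s \<le> rpow b s"
  by (simp add: rpow_def powr_mono2)

lemma Lq_norm_nonneg: "0 \<le> Lq_norm q f"
  by (simp add: Lq_norm_def)

lemma integrable_torus_powr:
  fixes f :: "real^'n \<Rightarrow> real"
  assumes "continuous_on (cbox 0 1) f" "\<And>x. x \<in> cbox 0 1 \<Longrightarrow> 0 \<le> f x" "q > 0"
  shows "integrable torus_measure (\<lambda>x. f x powr q)"
  using assms by (intro continuous_imp_integrable continuous_on_powr') auto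

text \<open>Two forms: the Lebesgue integral serves the measure estimates, the gauge integral the
  differentiation under the integral sign.\<close>

lemma Lq_norm_finite:
  fixes f :: "real^'n \<Rightarrow> real"
  assumes f: "continuous_on (cbox 0 1) f" "\<And>x. x \<in> cbox 0 1 \<Longrightarrow> 0 \<le> f x" and q: "q > 0"
  shows "Lq_norm (ennreal q) f = (LINT x|torus_measure. f x powr q) powr (1 / q)"
    and "Lq_norm (ennreal q) f = integral (cbox 0 1) (\<lambda>x. f x powr q) powr (1 / q)"
proof -
  have "(LINT x|torus_measure. \<bar>f x\<bar> powr q) = (LINT x|torus_measure. f x powr q)"
    using f(2) by (intro Bochner_Integration.integral_cong) auto
  then show *: "Lq_norm (ennreal q) f = (LINT x|torus_measure. f x powr q) powr (1 / q)"
    using q by (simp add: Lq_norm_def)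
  have "(LINT x|torus_measure. f x powr q) = integral (cbox 0 1) (\<lambda>x. f x powr q)"
    by (intro lebesgue_integral_eq_integral integrable_torus_powr f q) auto
  with * show "Lq_norm (ennreal q) f = integral (cbox 0 1) (\<lambda>x. f x powr q) powr (1 / q)" by simp
qed

lemma emeasure_torus: "emeasure (torus_measure :: (real^'n) measure) (space torus_measure) = 1"
proof -
  have "(\<Prod>b\<in>(Basis :: (real^'n) set). (1 - 0) \<bullet> b) = (\<Prod>b\<in>(Basis :: (real^'n) set). 1)"
    by (intro prod.cong refl) (auto simp: Basis_vec_def inner_axis)
  then show ?thesis
    by (simp add: emeasure_restrict_space emeasure_lborel_cbox_eq inner_axis Basis_vec_def)
qed

lemma measurable_torus:
  fixes f :: "real^'n \<Rightarrow> real"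
  assumes "continuous_on (cbox 0 1) f"
  shows "(\<lambda>x. ennreal \<bar>f x\<bar>) \<in> borel_measurable torus_measure"
proof -
  have "f \<in> borel_measurable torus_measure"
    using assms by (intro borel_measurable_integrable continuous_imp_integrable)
  then show ?thesis by measurable
qed

lemma esssup_torus_finite:
  fixes f :: "real^'n \<Rightarrow> real"
  assumes f: "continuous_on (cbox 0 1) f"
  shows "esssup torus_measure (\<lambda>x. ennreal \<bar>f x\<bar>) < \<infinity>"
proof -
  have "compact (f ` cbox 0 1)" using f by (intro compact_continuous_image) auto
  then have "bounded (f ` cbox 0 1)" by (rule compact_imp_bounded)
  then obtain B where "\<And>x. x \<in> cbox 0 1 \<Longrightarrow> \<bar>f x\<bar> \<le> B"
    unfolding bounded_iff by auto
  then have "esssup torus_measure (\<lambda>x. ennreal \<bar>f x\<bar>) \<le> ennreal B"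
    by (intro esssup_I measurable_torus f) (auto intro!: AE_I2 ennreal_leI)
  then show ?thesis using le_less_trans by fastforce
qed

text \<open>The torus has measure 1, so integrating the almost everywhere bound introduces no
  constant.\<close>

lemma Lq_norm_le_infinity:
  fixes f :: "real^'n \<Rightarrow> real"
  assumes f: "continuous_on (cbox 0 1) f" "\<And>x. x \<in> cbox 0 1 \<Longrightarrow> 0 \<le> f x" and q: "q > 0"
  shows "Lq_norm (ennreal q) f \<le> Lq_norm \<infinity> f"
proof -
  interpret finite_measure "torus_measure :: (real^'n) measure"
    by (rule finite_measureI, subst emeasure_torus) simp
  let ?N = "Lq_norm \<infinity> f"
  have fin: "esssup torus_measure (\<lambda>x. ennreal \<bar>f x\<bar>) < top"
    using esssup_torus_finite[OF f(1)] by simp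
  have "AE x in torus_measure. ennreal \<bar>f x\<bar> \<le> esssup torus_measure (\<lambda>x. ennreal \<bar>f x\<bar>)"
    by (rule esssup_AE)
  then have "AE x in torus_measure. \<bar>f x\<bar> \<le> ?N"
    by (rule AE_mp) (use fin in \<open>auto simp: Lq_norm_def dest!: enn2real_mono\<close>)
  then have ae: "AE x in torus_measure. f x powr q \<le> ?N powr q"
    by (rule AE_mp) (use f q in \<open>auto intro!: AE_I2 powr_mono2\<close>)
  have "(LINT x|torus_measure. f x powr q) \<le> (LINT x|(torus_measure :: (real^'n) measure). ?N powr q)"
    by (intro integral_mono_AE ae integrable_torus_powr f q) (auto simp: Lq_norm_nonneg)
  also have "\<dots> = ?N powr q" using emeasure_torus[where 'n = 'n] by (simp add: measure_def)
  finally have "(LINT x|torus_measure. f x powr q) powr (1 / q) \<le> (?N powr q) powr (1 / q)"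
    using q f by (intro powr_mono2 integral_nonneg_AE) auto
  also have "\<dots> = ?N" using q by (simp add: powr_powr Lq_norm_nonneg)
  finally show ?thesis by (simp add: Lq_norm_finite(1)[OF f q])
qed

text \<open>Chebyshev's inequality: \<open>\<mu>\<close> is the measure of the set where
  \<open>f > c\<close>, positive because \<open>c\<close> lies below the essential supremum. It must
  not depend on \<open>q\<close>, so that its power \<open>1 / q\<close> tends to 1.\<close>

lemma Lq_norm_infinity_approx:
  fixes f :: "real^'n \<Rightarrow> real"
  assumes f: "continuous_on (cbox 0 1) f" "\<And>x. x \<in> cbox 0 1 \<Longrightarrow> 0 \<le> f x"
    and c: "0 \<le> c" "c < Lq_norm \<infinity> f"
  shows "\<exists>\<mu>>0. \<forall>q>0. c * \<mu> powr (1 / q) \<le> Lq_norm (ennreal q) f"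
proof -
  interpret finite_measure "torus_measure :: (real^'n) measure"
    by (rule finite_measureI, subst emeasure_torus) simp
  let ?A = "{x \<in> space torus_measure. ennreal \<bar>f x\<bar> > ennreal c}"
  have "ennreal c < esssup torus_measure (\<lambda>x. ennreal \<bar>f x\<bar>)"
    using c esssup_torus_finite[OF f(1)] unfolding Lq_norm_def
    by (simp add: ennreal_less_iff[symmetric] del: ennreal_less_iff)
  then have pos: "emeasure torus_measure ?A > 0"
    by (rule esssup_pos_measure[OF measurable_torus[OF f(1)]])
  have A: "?A \<in> sets torus_measure" using measurable_torus[OF f(1)] by measurable
  define \<mu> where "\<mu> = measure torus_measure ?A"
  have \<mu>: "\<mu> > 0" using pos by (simp add: \<mu>_def emeasure_eq_measure)
  have "c * \<mu> powr (1 / q) \<le> Lq_norm (ennreal q) f" if q: "q > 0" for q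
  proof -
    have "c powr q * \<mu> = (LINT x|torus_measure. c powr q * indicator ?A x)"
      using A by (auto simp: \<mu>_def intro!: arg_cong[where f = "Sigma_Algebra.measure torus_measure"])
    also have "\<dots> \<le> (LINT x|torus_measure. f x powr q)"
    proof (intro integral_mono integrable_torus_powr f q)
      show "integrable torus_measure (\<lambda>x. c powr q * indicator ?A x)"
        by (intro integrable_mult_right integrable_real_indicator A) (simp add: less_top[symmetric])
      fix x :: "real^'n" assume "x \<in> space torus_measure"
      then show "c powr q * indicator ?A x \<le> f x powr q"
        using c q f(2) by (auto simp: indicator_def ennreal_less_iff intro!: powr_mono2)
    qed
    finally have "(c powr q * \<mu>) powr (1 / q) \<le> (LINT x|torus_measure. f x powr q) powr (1 / q)"
      using q \<mu> by (intro powr_mono2) auto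
    moreover have "(c powr q * \<mu>) powr (1 / q) = c * \<mu> powr (1 / q)"
      using q c \<mu> by (simp add: powr_mult powr_powr)
    ultimately show ?thesis by (simp add: Lq_norm_finite(1)[OF f q])
  qed
  with \<mu> show ?thesis by blast
qed

text \<open>If the bound failed, some \<open>c\<close> would lie strictly between its two sides. The
  lower estimate for \<open>f\<close> and the sup norm bounds for \<open>f0\<close> and
  \<open>f1\<close> then give \<open>c * \<mu> powr (1 / q) \<le> ?R\<close> for every
  \<open>q \<ge> 1\<close>, and the limit contradicts \<open>?R < c\<close>.\<close>

lemma Lq_norm_interpolation_infinity:
  fixes f f0 f1 :: "real^'n \<Rightarrow> real"
  assumes f: "continuous_on (cbox 0 1) f" "\<And>x. x \<in> cbox 0 1 \<Longrightarrow> 0 \<le> f x"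
    and f0: "continuous_on (cbox 0 1) f0" "\<And>x. x \<in> cbox 0 1 \<Longrightarrow> 0 \<le> f0 x"
    and f1: "continuous_on (cbox 0 1) f1" "\<And>x. x \<in> cbox 0 1 \<Longrightarrow> 0 \<le> f1 x"
    and ab: "0 \<le> a" "0 \<le> b"
    and le: "\<And>q. 1 \<le> q \<Longrightarrow>
      Lq_norm (ennreal q) f \<le> rpow (Lq_norm (ennreal q) f0) a * rpow (Lq_norm (ennreal q) f1) b"
  shows "Lq_norm \<infinity> f \<le> rpow (Lq_norm \<infinity> f0) a * rpow (Lq_norm \<infinity> f1) b"
proof (rule ccontr)
  let ?R = "rpow (Lq_norm \<infinity> f0) a * rpow (Lq_norm \<infinity> f1) b"
  assume "\<not> Lq_norm \<infinity> f \<le> ?R"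
  then obtain c where c: "?R < c" "c < Lq_norm \<infinity> f" by (meson dense not_le)
  have R: "0 \<le> ?R" by (simp add: rpow_nonneg)
  obtain \<mu> where \<mu>: "\<mu> > 0" "\<And>q. q > 0 \<Longrightarrow> c * \<mu> powr (1 / q) \<le> Lq_norm (ennreal q) f"
    using Lq_norm_infinity_approx[OF f, of c] c R by force
  have "c * \<mu> powr (1 / q) \<le> ?R" if q: "q \<ge> 1" for q
  proof -
    have "c * \<mu> powr (1 / q) \<le> rpow (Lq_norm (ennreal q) f0) a * rpow (Lq_norm (ennreal q) f1) b"
      using \<mu>(2)[of q] le[OF q] q by simp
    also have "\<dots> \<le> ?R"
      using q ab by (intro mult_mono rpow_mono Lq_norm_le_infinity f0 f1 Lq_norm_nonneg rpow_nonneg) auto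
    finally show ?thesis .
  qed
  moreover have "((\<lambda>q. c * \<mu> powr (1 / q)) \<longlongrightarrow> c * \<mu> powr 0) at_top"
    using \<mu>(1) by (intro tendsto_intros tendsto_divide_0[OF tendsto_const] filterlim_at_top_imp_at_infinity filterlim_ident) auto
  ultimately have "c * \<mu> powr 0 \<le> ?R"
    by (intro tendsto_upperbound[of _ _ at_top]) (auto intro: eventually_at_top_linorderI[of 1])
  with c \<mu>(1) show False by simp
qed

section \<open>The transported density\<close>

lemma pderiv_dir_mult:
  assumes "Ck_on (Suc k) f S" "Ck_on (Suc l) g S" "open S" "x \<in> S"
  shows "pderiv_dir v (\<lambda>z. f z * g z) x = f x * pderiv_dir v g x + pderiv_dir v f x * g x"
  using has_derivative_mult[OF has_derivative_pderiv_dir[OF assms(1,3,4)] has_derivative_pderiv_dir[OF assms(2,3,4)]]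
  by (rule pderiv_dir_eq)

lemma pderiv_dir_add:
  assumes "Ck_on (Suc k) f S" "Ck_on (Suc l) g S" "open S" "x \<in> S"
  shows "pderiv_dir v (\<lambda>z. f z + g z) x = pderiv_dir v f x + pderiv_dir v g x"
  using has_derivative_add[OF has_derivative_pderiv_dir[OF assms(1,3,4)] has_derivative_pderiv_dir[OF assms(2,3,4)]]
  by (rule pderiv_dir_eq)

lemma pderiv_dir_diff:
  assumes "Ck_on (Suc k) f S" "Ck_on (Suc l) g S" "open S" "x \<in> S"
  shows "pderiv_dir v (\<lambda>z. f z - g z) x = pderiv_dir v f x - pderiv_dir v g x"
  using has_derivative_diff[OF has_derivative_pderiv_dir[OF assms(1,3,4)] has_derivative_pderiv_dir[OF assms(2,3,4)]]
  by (rule pderiv_dir_eq)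

lemma pderiv_dir_sum:
  assumes "\<And>i. i \<in> I \<Longrightarrow> Ck_on (Suc k) (f i) S" "open S" "x \<in> S"
  shows "pderiv_dir v (\<lambda>z. \<Sum>i\<in>I. f i z) x = (\<Sum>i\<in>I. pderiv_dir v (f i) x)"
  by (rule pderiv_dir_eq[OF has_derivative_sum]) (rule has_derivative_pderiv_dir[OF assms])

text \<open>For \<open>a > 0\<close>, evaluate at the minimizer \<open>- b / a\<close>. For
  \<open>a = 0\<close> the polynomial is affine in \<open>c\<close>, and a nonzero slope would let
  it reach -1.\<close>

lemma discriminant_nonpos:
  fixes a b d :: real
  assumes q: "\<And>c. 0 \<le> c\<^sup>2 * a + 2 * c * b + d" and "0 \<le> a"
  shows "b\<^sup>2 \<le> a * d"
proof (cases "a = 0")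
  case True
  have "b = 0"
  proof (rule ccontr)
    assume "b \<noteq> 0"
    then show False using q[of "- (d + 1) / (2 * b)"] True by (simp add: field_simps)
  qed
  with True show ?thesis by simp
next
  case False
  then show ?thesis using q[of "- b / a"] \<open>0 \<le> a\<close>
    by (simp add: field_simps power2_eq_square)
qed

text \<open>
  Only first derivatives of \<open>P\<close> are used: \<open>P = m\<^sup>q\<close> need not be \<open>C\<^sup>2\<close> at the zeros of \<open>m\<close> when \<open>q < 2\<close>.
\<close>

lemma transport_log_convex:
  fixes P :: "(real^'n) \<times> real \<Rightarrow> real" and v :: "'n \<Rightarrow> (real^'n) \<times> real \<Rightarrow> real"
  assumes T: "T > 0" and q: "q \<ge> 1"
    and contP: "continuous_on (UNIV \<times> {0..T}) P"
    and P_nonneg: "\<And>x t. t \<in> {0..T} \<Longrightarrow> 0 \<le> P (x, t)"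
    and P: "Ck_on (Suc 0) P (UNIV \<times> {0<..<T})" and v: "\<And>i k. Ck_on k (v i) (UNIV \<times> {0<..<T})"
    and perP: "space_periodic {0<..<T} P" and perv: "\<And>i. space_periodic {0<..<T} (v i)"
    and transport: "\<And>z. z \<in> UNIV \<times> {0<..<T} \<Longrightarrow>
      dt P z = (\<Sum>i\<in>UNIV. dx i P z * v i z) + q * P z * (\<Sum>i\<in>UNIV. dx i (v i) z)"
    and force: "\<And>z. z \<in> UNIV \<times> {0<..<T} \<Longrightarrow>
      (\<Sum>i\<in>UNIV. dx i P z * (dt (v i) z - (\<Sum>k\<in>UNIV. v k z * dx k (v i) z))) \<le> 0"
    and trace: "\<And>z. z \<in> UNIV \<times> {0<..<T} \<Longrightarrow>
      0 \<le> (\<Sum>i\<in>UNIV. \<Sum>k\<in>UNIV. dx k (v i) z * dx i (v k) z)"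
    and t: "t \<in> {0<..<T}"
  shows "integral (cbox 0 1) (\<lambda>x. P (x, t)) \<le>
    integral (cbox 0 1) (\<lambda>x. P (x, 0)) powr (1 - t / T) * integral (cbox 0 1) (\<lambda>x. P (x, T)) powr (t / T)"
proof -
  let ?S = "(UNIV :: (real^'n) set) \<times> {0<..<T}"
  have op: "open ?S" by (intro open_Times) auto
  have dv: "Ck_on k (pderiv_dir a (v i)) ?S" for k a i
    using Ck_on_pderiv_dir[OF v op] .
  define D where "D z = (\<Sum>i\<in>UNIV. dx i (v i) z)" for z
  \<comment> \<open>The part of v_t beyond the transport term (Dv)v; hypothesis \<open>force\<close>
    concerns exactly this field.\<close>
  define w where "w i z = dt (v i) z - (\<Sum>k\<in>UNIV. v k z * dx k (v i) z)" for i z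
  have D: "Ck_on k D ?S" for k
    unfolding D_def by (intro Ck_on_sum dv)
  have w: "Ck_on k (w i) ?S" for k i
    unfolding w_def by (intro Ck_on_sum Ck_on_diff Ck_on_mult dv v)
  have perdv: "space_periodic {0<..<T} (pderiv_dir a (v i))" for a i
    by (rule space_periodic_pderiv_dir[OF perv v]) simp
  have perD: "space_periodic {0<..<T} D"
    using perdv unfolding D_def space_periodic_def by simp
  have perw: "space_periodic {0<..<T} (w i)" for i
    using perdv perv unfolding w_def space_periodic_def by simp
  have int: "(\<lambda>x. f (x, t)) integrable_on cbox 0 1" if "continuous_on ?S f" "t \<in> {0<..<T}" for f :: "_ \<Rightarrow> real" and t
    using that(2) by (intro integrable_continuous continuous_on_compose2[OF that(1)] continuous_intros) auto
  have cont: "continuous_on ?S P" "continuous_on ?S D"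
    using Ck_on_imp_continuous_on P D by blast+
  have PD: "Ck_on (Suc 0) (\<lambda>z. P z * D z) ?S"
    by (intro Ck_on_mult P D)
  define flux1 where "flux1 i z = P z * v i z" for i z
  define flux2 where "flux2 i z = P z * D z * v i z + P z * w i z" for i z
  have flux1: "Ck_on (Suc 0) (flux1 i) ?S" for i
    unfolding flux1_def by (intro Ck_on_mult P v)
  have flux2: "Ck_on (Suc 0) (flux2 i) ?S" for i
    unfolding flux2_def by (intro Ck_on_mult Ck_on_add P v D w)
  have perflux1: "space_periodic {0<..<T} (flux1 i)" for i
    using perP perv unfolding flux1_def space_periodic_def by simp
  have perflux2: "space_periodic {0<..<T} (flux2 i)" for i
    using perP perv perD perw unfolding flux2_def space_periodic_def by simp
  have no_flux: "integral (cbox 0 1) (\<lambda>x. (\<Sum>i\<in>UNIV. dx i (F i) (x, t)) + f (x, t)) = integral (cbox 0 1) (\<lambda>x. f (x, t))"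
    if F: "\<And>i. Ck_on (Suc 0) (F i) ?S" and per: "\<And>i. space_periodic {0<..<T} (F i)"
      and f: "continuous_on ?S f" and t: "t \<in> {0<..<T}"
    for F :: "'n \<Rightarrow> (real^'n) \<times> real \<Rightarrow> real" and f :: "(real^'n) \<times> real \<Rightarrow> real" and t
  proof -
    have i: "(\<lambda>x. dx i (F i) (x, t)) integrable_on cbox 0 1" for i
      using Ck_on_imp_continuous_on[OF Ck_on_pderiv_dir[OF F op]] int[OF _ t] by blast
    have z: "integral (cbox 0 1) (\<lambda>x. dx i (F i) (x, t)) = 0" for i
      by (rule integral_dx_eq_0[OF F per _ t]) simp
    show ?thesis
      by (subst Henstock_Kurzweil_Integration.integral_add)
        (simp_all add: i z int[OF f t] integrable_sum Henstock_Kurzweil_Integration.integral_sum)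
  qed
  have dtP: "dt P z = (\<Sum>i\<in>UNIV. dx i (flux1 i) z) + (q - 1) * (P z * D z)" if z: "z \<in> ?S" for z
    unfolding flux1_def pderiv_dir_mult[OF P v op z] transport[OF z] D_def[of z]
    by (simp add: sum.distrib algebra_simps flip: sum_distrib_left)
  \<comment> \<open>The divergence of v_t = w + (Dv)v. Differentiating the product gives the trace
    term, and symmetry of second derivatives turns the remaining terms into v . D(div v).\<close>
  have dtD: "dt D z = (\<Sum>i\<in>UNIV. dx i (w i) z)
      + (\<Sum>i\<in>UNIV. \<Sum>k\<in>UNIV. dx k (v i) z * dx i (v k) z) + (\<Sum>k\<in>UNIV. v k z * dx k D z)" if z: "z \<in> ?S" for z
  proof -
    have dxw: "dx i (w i) z = dx i (dt (v i)) z
        - (\<Sum>k\<in>UNIV. v k z * dx i (dx k (v i)) z + dx i (v k) z * dx k (v i) z)" for i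
    proof -
      have "dx i (w i) z = dx i (dt (v i)) z - dx i (\<lambda>z. \<Sum>k\<in>UNIV. v k z * dx k (v i) z) z"
        unfolding w_def by (rule pderiv_dir_diff[OF dv _ op z]) (intro Ck_on_sum Ck_on_mult dv v)
      also have "dx i (\<lambda>z. \<Sum>k\<in>UNIV. v k z * dx k (v i) z) z = (\<Sum>k\<in>UNIV. dx i (\<lambda>z. v k z * dx k (v i) z) z)"
        by (rule pderiv_dir_sum[OF _ op z]) (intro Ck_on_mult dv v)
      finally show ?thesis by (simp add: pderiv_dir_mult[OF v dv op z])
    qed
    have "dt D z = (\<Sum>i\<in>UNIV. dt (dx i (v i)) z)"
      unfolding D_def by (rule pderiv_dir_sum[OF dv op z])
    also have "\<dots> = (\<Sum>i\<in>UNIV. dx i (dt (v i)) z)"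
      by (intro sum.cong refl pderiv_dir_commute[OF v op z])
    also have "\<dots> = (\<Sum>i\<in>UNIV. dx i (w i) z) + (\<Sum>i\<in>UNIV. \<Sum>k\<in>UNIV. dx k (v i) z * dx i (v k) z)
        + (\<Sum>i\<in>UNIV. \<Sum>k\<in>UNIV. v k z * dx i (dx k (v i)) z)"
      unfolding dxw by (simp add: sum_subtractf sum.distrib mult.commute)
    also have "(\<Sum>i\<in>UNIV. \<Sum>k\<in>UNIV. v k z * dx i (dx k (v i)) z) = (\<Sum>k\<in>UNIV. v k z * dx k D z)"
    proof -
      have "dx k D z = (\<Sum>i\<in>UNIV. dx i (dx k (v i)) z)" for k
      proof -
        have "dx k D z = (\<Sum>i\<in>UNIV. dx k (dx i (v i)) z)"
          unfolding D_def by (rule pderiv_dir_sum[OF dv op z])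
        also have "\<dots> = (\<Sum>i\<in>UNIV. dx i (dx k (v i)) z)"
          by (intro sum.cong refl pderiv_dir_commute[OF v op z])
        finally show ?thesis .
      qed
      then show ?thesis by (subst sum.swap) (simp add: sum_distrib_left)
    qed
    finally show ?thesis .
  qed
  \<comment> \<open>the divergence \<open>div(P D v + P w)\<close> absorbs the second derivatives of \<open>v\<close>\<close>
  have dtPD: "(\<Sum>i\<in>UNIV. dx i (flux2 i) z) + (q - 1) * (P z * (D z)\<^sup>2) \<le> dt (\<lambda>z. P z * D z) z" if z: "z \<in> ?S" for z
  proof -
    have "dx i (flux2 i) z = P z * D z * dx i (v i) z + (P z * dx i D z + dx i P z * D z) * v i z
        + (P z * dx i (w i) z + dx i P z * w i z)" for i
      unfolding flux2_def
      by (subst pderiv_dir_add[OF Ck_on_mult[OF PD v] Ck_on_mult[OF P w] op z])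
        (simp add: pderiv_dir_mult[OF PD v op z] pderiv_dir_mult[OF P D op z] pderiv_dir_mult[OF P w op z])
    \<comment> \<open>The divergence takes one copy of \<open>P z * (D z)\<^sup>2\<close> out of the
      \<open>q\<close> copies contributed by \<open>dt P z * D z\<close>; hence the factor
      \<open>q - 1\<close>.\<close>
    then have "(\<Sum>i\<in>UNIV. dx i (flux2 i) z) = P z * (D z)\<^sup>2 + P z * (\<Sum>i\<in>UNIV. v i z * dx i D z)
        + D z * (\<Sum>i\<in>UNIV. dx i P z * v i z) + P z * (\<Sum>i\<in>UNIV. dx i (w i) z) + (\<Sum>i\<in>UNIV. dx i P z * w i z)"
      by (simp add: sum.distrib sum_distrib_left D_def power2_eq_square algebra_simps)
    moreover have "dt (\<lambda>z. P z * D z) z = P z * dt D z + dt P z * D z"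
      by (rule pderiv_dir_mult[OF P D op z])
    moreover have "0 \<le> P z * (\<Sum>i\<in>UNIV. \<Sum>k\<in>UNIV. dx k (v i) z * dx i (v k) z)"
      using trace[OF z] P_nonneg z by (cases z) (auto intro!: mult_nonneg_nonneg)
    moreover have "(\<Sum>i\<in>UNIV. dx i P z * w i z) \<le> 0"
      using force[OF z] by (simp add: w_def)
    moreover have "dt P z = (\<Sum>i\<in>UNIV. dx i P z * v i z) + q * P z * D z"
      using transport[OF z] by (simp add: D_def)
    ultimately show ?thesis
      unfolding dtD[OF z] by (simp add: algebra_simps power2_eq_square)
  qed
  define \<phi> where "\<phi> t = integral (cbox 0 1) (\<lambda>x. P (x, t))" for t
  define I1 where "I1 t = integral (cbox 0 1) (\<lambda>x. P (x, t) * D (x, t))" for t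
  define I2 where "I2 t = integral (cbox 0 1) (\<lambda>x. dt (\<lambda>z. P z * D z) (x, t))" for t
  define J where "J t = integral (cbox 0 1) (\<lambda>x. P (x, t) * (D (x, t))\<^sup>2)" for t
  have contPD: "continuous_on ?S (\<lambda>z. P z * D z)" "continuous_on ?S (\<lambda>z. P z * (D z)\<^sup>2)"
    by (intro continuous_intros cont)+
  have d1: "(\<phi> has_real_derivative (q - 1) * I1 t) (at t)" if t: "t \<in> {0<..<T}" for t
  proof -
    have "integral (cbox 0 1) (\<lambda>x. dt P (x, t))
        = integral (cbox 0 1) (\<lambda>x. (\<Sum>i\<in>UNIV. dx i (flux1 i) (x, t)) + (q - 1) * (P (x, t) * D (x, t)))"
      using dtP t by (intro integral_cong) auto
    also have "\<dots> = integral (cbox 0 1) (\<lambda>x. (q - 1) * (P (x, t) * D (x, t)))"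
      by (rule no_flux[OF flux1 perflux1 _ t, where f = "\<lambda>z. (q - 1) * (P z * D z)"])
        (intro continuous_intros cont)
    also have "\<dots> = (q - 1) * I1 t" by (simp add: I1_def)
    finally show ?thesis
      using has_real_derivative_integral_dt[OF P t] by (simp add: \<phi>_def[abs_def])
  qed
  have d2: "((\<lambda>t. (q - 1) * I1 t) has_real_derivative (q - 1) * I2 t) (at t)" if t: "t \<in> {0<..<T}" for t
    unfolding I1_def I2_def by (intro DERIV_cmult has_real_derivative_integral_dt[OF PD t])
  have I2: "(q - 1) * J t \<le> I2 t" if t: "t \<in> {0<..<T}" for t
  proof -
    have "(q - 1) * J t = integral (cbox 0 1) (\<lambda>x. (q - 1) * (P (x, t) * (D (x, t))\<^sup>2))"
      by (simp add: J_def)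
    also have "\<dots> = integral (cbox 0 1) (\<lambda>x. (\<Sum>i\<in>UNIV. dx i (flux2 i) (x, t)) + (q - 1) * (P (x, t) * (D (x, t))\<^sup>2))"
      by (rule no_flux[OF flux2 perflux2 _ t, where f = "\<lambda>z. (q - 1) * (P z * (D z)\<^sup>2)", symmetric])
        (intro continuous_intros cont)
    also have "\<dots> \<le> I2 t"
      unfolding I2_def
    proof (rule integral_le)
      show "(\<lambda>x. (\<Sum>i\<in>UNIV. dx i (flux2 i) (x, t)) + (q - 1) * (P (x, t) * (D (x, t))\<^sup>2)) integrable_on cbox 0 1"
        by (rule int[OF _ t, where f = "\<lambda>z. (\<Sum>i\<in>UNIV. dx i (flux2 i) z) + (q - 1) * (P z * (D z)\<^sup>2)"])
          (intro continuous_intros cont Ck_on_imp_continuous_on[OF Ck_on_pderiv_dir[OF flux2 op]])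
      show "(\<lambda>x. dt (\<lambda>z. P z * D z) (x, t)) integrable_on cbox 0 1"
        by (rule int[OF Ck_on_imp_continuous_on[OF Ck_on_pderiv_dir[OF PD op]] t])
    qed (use dtPD t in auto)
    finally show ?thesis .
  qed
  have nonneg: "0 \<le> \<phi> t" if "t \<in> {0..T}" for t
    unfolding \<phi>_def using P_nonneg[OF that] that
    by (intro integral_nonneg integrable_continuous continuous_on_compose2[OF contP] continuous_intros) auto
  have J: "0 \<le> J t" if t: "t \<in> {0<..<T}" for t
    unfolding J_def using P_nonneg t
    by (intro integral_nonneg int[OF contPD(2) t]) auto
  \<comment> \<open>The integral of P (c + D)^2 is a quadratic polynomial in \<open>c\<close> that
    is never negative.\<close>
  have cauchy_schwarz: "(I1 t)\<^sup>2 \<le> \<phi> t * J t" if t: "t \<in> {0<..<T}" for t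
  proof (rule discriminant_nonpos)
    fix c :: real
    have "0 \<le> integral (cbox 0 1) (\<lambda>x. P (x, t) * (c + D (x, t))\<^sup>2)"
      using P_nonneg t
      by (intro integral_nonneg int[OF _ t, where f = "\<lambda>z. P z * (c + D z)\<^sup>2"] continuous_intros cont) auto
    also have "\<dots> = integral (cbox 0 1) (\<lambda>x. c\<^sup>2 * P (x, t) + 2 * c * (P (x, t) * D (x, t)) + P (x, t) * (D (x, t))\<^sup>2)"
      by (intro integral_cong) (simp add: power2_eq_square algebra_simps)
    also have "\<dots> = c\<^sup>2 * \<phi> t + 2 * c * I1 t + J t"
      unfolding \<phi>_def I1_def J_def
      by (intro integral_unique has_integral_add has_integral_mult_right integrable_integral
          int[OF cont(1) t] int[OF contPD(1) t] int[OF contPD(2) t])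
    finally show "0 \<le> c\<^sup>2 * \<phi> t + 2 * c * I1 t + J t" .
  qed (use nonneg t in auto)
  have "\<phi> t \<le> \<phi> 0 powr (1 - t / T) * \<phi> T powr (t / T)"
  proof (rule log_convex_interpolation[OF T _ nonneg d1 d2 _ _ t])
    have "continuous_on ({0..T} \<times> cbox 0 1) (\<lambda>(t, x). P (x, t))"
      unfolding case_prod_beta by (intro continuous_on_compose2[OF contP] continuous_intros) auto
    then show "continuous_on {0..T} \<phi>"
      unfolding \<phi>_def by (rule integral_continuous_on_param)
  next
    fix t assume t: "t \<in> {0<..<T}"
    have "0 \<le> (q - 1) * J t" using q J[OF t] by simp
    then show "0 \<le> (q - 1) * I2 t" using q I2[OF t] by simp
    \<comment> \<open>One factor \<open>q - 1\<close> belongs to \<phi>'', the other comes from the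
      lower bound for \<open>I2\<close>; together they match the square on the left.\<close>
    have "((q - 1) * I1 t)\<^sup>2 \<le> (q - 1)\<^sup>2 * (\<phi> t * J t)"
      using cauchy_schwarz[OF t] by (simp add: power_mult_distrib mult_left_mono)
    also have "\<dots> = \<phi> t * ((q - 1) * ((q - 1) * J t))" by (simp add: power2_eq_square)
    also have "\<dots> \<le> \<phi> t * ((q - 1) * I2 t)"
      using nonneg[of t] t I2[OF t] q by (intro mult_left_mono) auto
    finally show "((q - 1) * I1 t)\<^sup>2 \<le> \<phi> t * ((q - 1) * I2 t)" .
  qed auto
  then show ?thesis by (simp add: \<phi>_def)
qed

section \<open>Mean field games\<close>

text \<open>The case \<open>q = 1\<close> is separate because \<open>0 powr 0 = 0\<close>.\<close>

lemma has_real_derivative_powr_nonneg: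
  fixes q :: real
  assumes "q \<ge> 1" "r \<ge> 0"
  shows "((\<lambda>r. r powr q) has_real_derivative (if q = 1 then 1 else q * r powr (q - 1))) (at r within {0..})"
proof -
  consider "r > 0" | "r = 0" "q = 1" | "r = 0" "q > 1" using assms by linarith
  then show ?thesis
  proof cases
    case 1
    then show ?thesis
      using has_field_derivative_at_within[OF has_real_derivative_powr[OF 1, of q]] by auto
  next
    case 2
    then show ?thesis
      by (auto intro!: has_field_derivative_transform_within[OF DERIV_ident zero_less_one])
  next
    case 3
    have "continuous_on {0..} (\<lambda>y::real. y powr (q - 1))"
      using 3 by (intro continuous_on_powr' continuous_intros) auto
    then have "((\<lambda>y. y powr (q - 1)) \<longlongrightarrow> 0 powr (q - 1)) (at 0 within {0..})"
      unfolding continuous_on by (rule bspec) simp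
    moreover have "\<forall>\<^sub>F y in at 0 within {0..}. y powr (q - 1) = (y powr q - 0 powr q) / (y - 0)"
      unfolding eventually_at_filter using 3 by (auto simp: powr_diff)
    ultimately have "((\<lambda>y. (y powr q - 0 powr q) / (y - 0)) \<longlongrightarrow> 0) (at 0 within {0..})"
      by (simp add: tendsto_cong)
    then show ?thesis using 3 by (simp add: has_field_derivative_iff)
  qed
qed

text \<open>One derivative, one-sided at 0, is what makes \<open>M powr q\<close> continuously
  differentiable across the zeros of a nonnegative \<open>M\<close>.\<close>

lemma Ck_on_powr_nonneg:
  assumes "q \<ge> 1"
  shows "Ck_on (Suc 0) (\<lambda>r::real. r powr q) {0..}"
  unfolding Ck_on.simps
proof (intro exI[of _ "\<lambda>r h. h * (if q = 1 then 1 else q * r powr (q - 1))"] conjI ballI allI)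
  fix r :: real assume "r \<in> {0..}"
  then show "((\<lambda>r. r powr q) has_derivative (\<lambda>h. h * (if q = 1 then 1 else q * r powr (q - 1)))) (at r within {0..})"
    using has_real_derivative_powr_nonneg[OF assms, of r] by (simp only: has_field_derivative_def mult_commute_abs atLeast_iff)
next
  fix h :: real
  show "continuous_on {0..} (\<lambda>r. h * (if q = 1 then 1 else q * r powr (q - 1)))"
    using assms by (cases "q = 1") (auto intro!: continuous_intros continuous_on_powr')
qed

text \<open>At a zero of \<open>M\<close> the outer function has only a one-sided derivative. This
  suffices because \<open>M\<close> maps the open set \<open>S\<close> into the half-line, so the
  chain rule within sets yields a full derivative.\<close>

lemma pderiv_dir_compose_nonneg:
  assumes g: "(g has_real_derivative c) (at (M z) within {0..})"
    and M: "Ck_on (Suc k) M S" "open S" "z \<in> S" and nonneg: "\<And>z. z \<in> S \<Longrightarrow> 0 \<le> M z"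
  shows "((\<lambda>z. g (M z)) has_derivative (\<lambda>a. c * pderiv_dir a M z)) (at z)"
    and "pderiv_dir a (\<lambda>z. g (M z)) z = c * pderiv_dir a M z"
proof -
  have "(M has_derivative (\<lambda>a. pderiv_dir a M z)) (at z within S)"
    using has_derivative_pderiv_dir[OF M] by (rule has_derivative_at_withinI)
  moreover have "(g has_derivative (\<lambda>h. c * h)) (at (M z) within M ` S)"
    using g unfolding has_field_derivative_def by (rule has_derivative_subset) (use nonneg in auto)
  ultimately have "((\<lambda>z. g (M z)) has_derivative (\<lambda>a. c * pderiv_dir a M z)) (at z within S)"
    by (rule has_derivative_in_compose)
  then show *: "((\<lambda>z. g (M z)) has_derivative (\<lambda>a. c * pderiv_dir a M z)) (at z)"
    by (simp only: at_within_open[OF M(3,2)])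
  show "pderiv_dir a (\<lambda>z. g (M z)) z = c * pderiv_dir a M z"
    using * by (rule pderiv_dir_eq)
qed

lemma Ck_on_compose_vec:
  fixes f :: "real^'n \<Rightarrow> real"
  assumes "Ck_on k f UNIV" "\<And>j. Ck_on k (p j) S"
  shows "Ck_on k (\<lambda>z. f (\<chi> j. p j z)) S"
proof (rule Ck_on_compose[OF assms(1)])
  fix b :: "real^'n" assume "b \<in> Basis"
  then obtain j where "b = axis j 1" by (auto simp: Basis_vec_def)
  then show "Ck_on k (\<lambda>z. (\<chi> j. p j z) \<bullet> b) S" using assms(2)[of j] by (simp add: inner_axis)
qed simp

lemma has_derivative_vec_lambda:
  fixes p :: "'n::finite \<Rightarrow> 'a::real_normed_vector \<Rightarrow> real"
  assumes "\<And>j. (p j has_derivative p' j) (at z)"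
  shows "((\<lambda>z. \<chi> j. p j z) has_derivative (\<lambda>h. \<chi> j. p' j h)) (at z)"
  using assms by (subst has_derivative_componentwise_within) (auto simp: Basis_vec_def inner_axis)

lemma pderiv_dir_compose_vec:
  fixes f :: "real^'n \<Rightarrow> real"
  assumes f: "Ck_on (Suc k) f UNIV" and p: "\<And>j. Ck_on (Suc l) (p j) S" and S: "open S" "z \<in> S"
  shows "((\<lambda>z. f (\<chi> j. p j z)) has_derivative
      (\<lambda>a. \<Sum>j\<in>UNIV. pderiv_dir (axis j 1) f (\<chi> j. p j z) * pderiv_dir a (p j) z)) (at z)"
    and "pderiv_dir a (\<lambda>z. f (\<chi> j. p j z)) z =
      (\<Sum>j\<in>UNIV. pderiv_dir (axis j 1) f (\<chi> j. p j z) * pderiv_dir a (p j) z)"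
proof -
  note df = has_derivative_pderiv_dir[OF f open_UNIV UNIV_I]
  have "((\<lambda>z. f (\<chi> j. p j z)) has_derivative
      (\<lambda>a. pderiv_dir (\<chi> j. pderiv_dir a (p j) z) f (\<chi> j. p j z))) (at z)"
    by (rule has_derivative_compose[OF has_derivative_vec_lambda df]) (rule has_derivative_pderiv_dir[OF p S])
  then show *: "((\<lambda>z. f (\<chi> j. p j z)) has_derivative
      (\<lambda>a. \<Sum>j\<in>UNIV. pderiv_dir (axis j 1) f (\<chi> j. p j z) * pderiv_dir a (p j) z)) (at z)"
    by (subst (asm) pderiv_dir_sum_axis[OF df]) (simp add: mult.commute)
  show "pderiv_dir a (\<lambda>z. f (\<chi> j. p j z)) z =
      (\<Sum>j\<in>UNIV. pderiv_dir (axis j 1) f (\<chi> j. p j z) * pderiv_dir a (p j) z)"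
    using * by (rule pderiv_dir_eq)
qed

lemma mono_on_nonneg_derivative:
  fixes g :: "real \<Rightarrow> real"
  assumes "mono_on {0..} g" "(g has_real_derivative c) (at r within {0..})" "r \<ge> 0"
  shows "0 \<le> c"
proof (rule tendsto_lowerbound)
  show "((\<lambda>y. (g y - g r) / (y - r)) \<longlongrightarrow> c) (at r within {0..})"
    using assms(2) by (simp add: has_field_derivative_iff)
  have "0 \<le> (g y - g r) / (y - r)" if "y \<in> {0..}" for y
    using that assms(3) mono_onD[OF assms(1), of y r] mono_onD[OF assms(1), of r y]
    by (cases "y \<le> r") (auto intro: divide_nonpos_nonpos)
  then show "\<forall>\<^sub>F y in at r within {0..}. 0 \<le> (g y - g r) / (y - r)"
    by (simp add: eventually_at_filter)
  have "at r within {r..} \<le> at r within {0..}" using assms(3) by (intro at_le) auto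
  moreover have "at r within {r..} \<noteq> bot" using at_within_Ici_at_right[of r] trivial_limit_at_right_real[of r] by simp
  ultimately show "at r within {0..} \<noteq> bot" by (metis bot.extremum_uniqueI)
qed

section \<open>From time slices, gradients and divergences to space-time partial derivatives\<close>

lemma has_derivative_space_slice:
  fixes f :: "(real^'n) \<times> real \<Rightarrow> real"
  assumes "(f has_derivative (\<lambda>a. f' a)) (at (x, t))"
  shows "((\<lambda>y. f (y, t)) has_derivative (\<lambda>h. f' (h, 0))) (at x)"
  by (rule has_derivative_compose[of "\<lambda>y. (y, t)" "\<lambda>h. (h, 0)" x UNIV f])
    (use assms in \<open>auto intro!: derivative_eq_intros\<close>)

lemma grad_eq:
  fixes f :: "real^'n \<Rightarrow> real"
  assumes "(f has_derivative f') (at x)"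
  shows "grad f x = (\<chi> i. f' (axis i 1))"
proof -
  have eq: "f' h = h \<bullet> (\<chi> i. f' (axis i 1))" for h
    using pderiv_dir_sum_axis[of f x h] assms pderiv_dir_eq[OF assms]
    by (simp add: inner_vec_def)
  have "GDERIV f x :> (\<chi> i. f' (axis i 1))"
    unfolding gderiv_def using assms by (simp flip: eq)
  moreover have "D = (\<chi> i. f' (axis i 1))" if "GDERIV f x :> D" for D
  proof -
    have "f' = (\<lambda>h. h \<bullet> D)"
      using has_derivative_unique[OF assms that[unfolded gderiv_def]] .
    then show ?thesis by (simp add: vec_eq_iff inner_axis')
  qed
  ultimately show ?thesis unfolding grad_def by blast
qed

lemma divergence_eq:
  fixes F :: "'n \<Rightarrow> real^'n \<Rightarrow> real"
  assumes "\<And>i. (F i has_derivative F' i) (at x)"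
  shows "divergence (\<lambda>y. \<chi> i. F i y) x = (\<Sum>i\<in>UNIV. F' i (axis i 1))"
proof -
  have "((\<lambda>y. \<chi> i. F i y) has_derivative (\<lambda>h. \<chi> i. F' i h)) (at x)"
    using assms by (rule has_derivative_vec_lambda)
  from frechet_derivative_at[OF this, symmetric] show ?thesis
    by (simp add: divergence_def)
qed

text \<open>The equations are phrased by space-time partial derivatives on the open strip. The work
  is to verify the three structural hypotheses of \<open>transport_log_convex\<close> for
  \<open>M powr q\<close> and the field \<open>v\<close>.\<close>

lemma mfg_Lq_norm_interpolation_finite:
  fixes H :: "real^'n \<Rightarrow> real" and U M :: "(real^'n) \<times> real \<Rightarrow> real"
  defines "p \<equiv> \<lambda>z. \<chi> j. dx j U z"
  defines "v \<equiv> \<lambda>i z. pderiv_dir (axis i 1) H (p z)"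
  assumes T: "T > 0" and q: "q \<ge> 1"
    and g: "smooth_on g {0..}" "mono_on {0..} g" and H: "smooth_on H UNIV" "convex_on UNIV H"
    and U: "smooth_on U (UNIV \<times> {0<..<T})" and M: "smooth_on M (UNIV \<times> {0<..<T})"
    and contM: "continuous_on (UNIV \<times> {0..T}) M"
    and perU: "space_periodic {0<..<T} U" and perM: "space_periodic {0<..<T} M"
    and M_nonneg: "\<And>x t. t \<in> {0..T} \<Longrightarrow> 0 \<le> M (x, t)"
    and hj: "\<And>z. z \<in> UNIV \<times> {0<..<T} \<Longrightarrow> dt U z = H (p z) - g (M z)"
    and continuity: "\<And>z. z \<in> UNIV \<times> {0<..<T} \<Longrightarrow> dt M z = (\<Sum>i\<in>UNIV. dx i (\<lambda>z. M z * v i z) z)"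
    and t: "t \<in> {0<..<T}"
  shows "integral (cbox 0 1) (\<lambda>x. M (x, t) powr q) \<le>
    integral (cbox 0 1) (\<lambda>x. M (x, 0) powr q) powr (1 - t / T) *
    integral (cbox 0 1) (\<lambda>x. M (x, T) powr q) powr (t / T)"
proof -
  let ?S = "(UNIV :: (real^'n) set) \<times> {0<..<T}"
  have op: "open ?S" by (intro open_Times) auto
  have Uk: "Ck_on k U ?S" and Mk: "Ck_on k M ?S" and Hk: "Ck_on k H UNIV" and gk: "Ck_on k g {0..}" for k
    using U M H(1) g(1) by (simp_all add: smooth_on_def)
  have dU: "Ck_on k (pderiv_dir a U) ?S" for a k
    by (rule Ck_on_pderiv_dir[OF Uk op])
  have dH: "Ck_on k (pderiv_dir a H) UNIV" for a k
    by (rule Ck_on_pderiv_dir[OF Hk open_UNIV])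
  have vk: "Ck_on k (v i) ?S" for k i
    unfolding v_def p_def by (rule Ck_on_compose_vec[OF dH dU])
  have M0: "0 \<le> M z" if "z \<in> ?S" for z using that M_nonneg by (cases z) auto
  have perv: "space_periodic {0<..<T} (v i)" for i
    using space_periodic_pderiv_dir[OF perU Uk] unfolding v_def p_def space_periodic_def by simp
  define A where "A z i j = pderiv_dir (axis j 1) (pderiv_dir (axis i 1) H) (p z)" for z i j
  have A_sym: "A z i j = A z j i" for z i j
    unfolding A_def by (rule pderiv_dir_commute[OF Hk open_UNIV UNIV_I])
  have A_psd: "0 \<le> (\<Sum>i\<in>UNIV. \<Sum>j\<in>UNIV. x i * A z i j * x j)" for z x
    using convex_on_hessian_nonneg[OF Hk H(2), of x "p z"]
    by (subst A_sym) (simp add: A_def)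
  have dv: "pderiv_dir a (v i) z = (\<Sum>j\<in>UNIV. A z i j * pderiv_dir a (dx j U) z)" if "z \<in> ?S" for a i z
    unfolding v_def p_def A_def by (rule pderiv_dir_compose_vec(2)[OF dH dU op that])
  have comm: "pderiv_dir a (pderiv_dir b U) z = pderiv_dir b (pderiv_dir a U) z" if "z \<in> ?S" for a b z
    by (rule pderiv_dir_commute[OF Uk op that])
  have "\<exists>g'. (g has_real_derivative g') (at r within {0..})" if "r \<ge> 0" for r
  proof -
    obtain D where "\<forall>x\<in>{0..}. (g has_derivative D x) (at x within {0..})"
      using gk[of "Suc 0"] by auto
    then have D: "(g has_derivative D r) (at r within {0..})" using that by simp
    have "h * D r 1 = D r h" for h
      using linear_cmul[OF has_derivative_linear[OF D], of h 1] by simp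
    then show ?thesis using has_derivative_imp_has_field_derivative[OF D] by blast
  qed
  then obtain g' where g': "\<And>r. r \<ge> 0 \<Longrightarrow> (g has_real_derivative g' r) (at r within {0..})"
    by metis
  have force: "dt (v i) z - (\<Sum>k\<in>UNIV. v k z * dx k (v i) z) = - g' (M z) * (\<Sum>j\<in>UNIV. A z i j * dx j M z)"
    if z: "z \<in> ?S" for i z
  proof -
    \<comment> \<open>The Hamilton-Jacobi equation differentiated in x_j, after exchanging the time
      and space derivatives of \<open>U\<close>; contracting with the Hessian \<open>A\<close> of
      \<open>H\<close> then gives the time derivative of \<open>v\<close>.\<close>
    have dtp: "dt (dx j U) z = (\<Sum>k\<in>UNIV. v k z * dx k (dx j U) z) - g' (M z) * dx j M z" for j
    proof -
      have "((\<lambda>z. H (p z) - g (M z)) has_derivative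
          (\<lambda>a. (\<Sum>k\<in>UNIV. v k z * pderiv_dir a (dx k U) z) - g' (M z) * pderiv_dir a M z)) (at z)"
        unfolding v_def p_def
        by (intro has_derivative_diff pderiv_dir_compose_vec(1)[OF Hk dU op z]
            pderiv_dir_compose_nonneg(1)[OF g' Mk op z] M0 z)
      then have "(dt U has_derivative
          (\<lambda>a. (\<Sum>k\<in>UNIV. v k z * pderiv_dir a (dx k U) z) - g' (M z) * pderiv_dir a M z)) (at z)"
        by (rule has_derivative_transform_within_open[OF _ op z]) (simp add: hj)
      then show ?thesis
        unfolding comm[OF z, of "(0, 1)"] by (subst comm[OF z]) (rule pderiv_dir_eq)
    qed
    have "dt (v i) z = (\<Sum>j\<in>UNIV. \<Sum>k\<in>UNIV. v k z * (A z i j * dx k (dx j U) z)) - g' (M z) * (\<Sum>j\<in>UNIV. A z i j * dx j M z)"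
      unfolding dv[OF z] dtp
      by (simp add: sum_distrib_left sum_subtractf right_diff_distrib mult_ac)
    moreover have "(\<Sum>k\<in>UNIV. v k z * dx k (v i) z) = (\<Sum>j\<in>UNIV. \<Sum>k\<in>UNIV. v k z * (A z i j * dx k (dx j U) z))"
      unfolding dv[OF z] sum_distrib_left by (rule sum.swap)
    ultimately show ?thesis by simp
  qed
  \<comment> \<open>The derivative of r^q. The only property of it that the transport equation for
    \<open>?P\<close> needs is \<kappa>(r) r = q r^q, valid also at r = 0.\<close>
  define \<kappa> where "\<kappa> r = (if q = 1 then 1 else q * r powr (q - 1))" for r
  have \<kappa>_nonneg: "0 \<le> \<kappa> r" for r using q by (simp add: \<kappa>_def)
  have \<kappa>: "\<kappa> r * r = q * r powr q" if "r \<ge> 0" for r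
    using that q by (cases "r = 0") (auto simp: \<kappa>_def powr_diff)
  let ?P = "\<lambda>z. M z powr q"
  have dP: "pderiv_dir a ?P z = \<kappa> (M z) * pderiv_dir a M z" if "z \<in> ?S" for a z
    unfolding \<kappa>_def
    by (rule pderiv_dir_compose_nonneg(2)[OF has_real_derivative_powr_nonneg[OF q] Mk op that])
      (use M0 that in auto)
  show ?thesis
  proof (rule transport_log_convex[where P = ?P and v = v, OF T q _ _ _ vk _ perv _ _ _ t])
    show "continuous_on (UNIV \<times> {0..T}) ?P"
      using M_nonneg q by (intro continuous_on_powr' contM continuous_intros) auto
    show "Ck_on (Suc 0) ?P ?S"
      by (rule Ck_on_compose[OF Ck_on_powr_nonneg[OF q]]) (use Mk M0 in auto)
    show "space_periodic {0<..<T} ?P" using perM by (simp add: space_periodic_def)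
  next
    fix z assume z: "z \<in> ?S"
    have "dt M z = M z * (\<Sum>i\<in>UNIV. dx i (v i) z) + (\<Sum>i\<in>UNIV. dx i M z * v i z)"
      unfolding continuity[OF z] pderiv_dir_mult[OF Mk vk op z] by (simp add: sum.distrib sum_distrib_left)
    then show "dt ?P z = (\<Sum>i\<in>UNIV. dx i ?P z * v i z) + q * M z powr q * (\<Sum>i\<in>UNIV. dx i (v i) z)"
      unfolding dP[OF z] \<kappa>[OF M0[OF z], symmetric] by (simp add: sum_distrib_left algebra_simps)
    \<comment> \<open>Both DP and the force are built from DM, one as \<kappa>(M) DM and the other
      as -g'(M) A DM, so their product is minus a positive semidefinite form at DM.\<close>
    have "(\<Sum>i\<in>UNIV. dx i ?P z * (dt (v i) z - (\<Sum>k\<in>UNIV. v k z * dx k (v i) z)))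
        = - (\<kappa> (M z) * g' (M z) * (\<Sum>i\<in>UNIV. \<Sum>j\<in>UNIV. dx i M z * A z i j * dx j M z))"
      unfolding dP[OF z] force[OF z] by (simp add: sum_distrib_left sum_negf algebra_simps)
    moreover have "0 \<le> g' (M z)" using mono_on_nonneg_derivative[OF g(2) g'] M0[OF z] by simp
    ultimately show "(\<Sum>i\<in>UNIV. dx i ?P z * (dt (v i) z - (\<Sum>k\<in>UNIV. v k z * dx k (v i) z))) \<le> 0"
      using \<kappa>_nonneg A_psd by simp
    show "0 \<le> (\<Sum>i\<in>UNIV. \<Sum>k\<in>UNIV. dx k (v i) z * dx i (v k) z)"
      using trace_psd_symmetric_square_nonneg[where A = "A z" and B = "\<lambda>j k. dx k (dx j U) z", OF A_sym A_psd comm[OF z]]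
      unfolding dv[OF z] .
  qed auto
qed

lemma smooth_on_subset: "smooth_on f S \<Longrightarrow> S' \<subseteq> S \<Longrightarrow> smooth_on f S'"
  unfolding smooth_on_def using Ck_on_subset by blast

lemma Zn_periodic_imp_space_periodic:
  assumes "\<forall>t\<in>J. Zn_periodic (\<lambda>x. f x t)"
  shows "space_periodic J (\<lambda>(x, t). f x t)"
  using assms unfolding space_periodic_def Zn_periodic_def by (auto simp: axis_def)

lemma Lq_norm_interpolation_finite:
  fixes f :: "real^'n \<Rightarrow> real \<Rightarrow> real"
  assumes T: "T > 0" and q: "q \<ge> 1" and t: "t \<in> {0..T}"
    and cont: "\<And>t. t \<in> {0..T} \<Longrightarrow> continuous_on (cbox 0 1) (\<lambda>x. f x t)"
    and nonneg: "\<And>x t. t \<in> {0..T} \<Longrightarrow> 0 \<le> f x t"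
    and le: "t \<in> {0<..<T} \<Longrightarrow> integral (cbox 0 1) (\<lambda>x. f x t powr q) \<le>
      integral (cbox 0 1) (\<lambda>x. f x 0 powr q) powr (1 - t / T) *
      integral (cbox 0 1) (\<lambda>x. f x T powr q) powr (t / T)"
  shows "Lq_norm (ennreal q) (\<lambda>x. f x t) \<le>
    rpow (Lq_norm (ennreal q) (\<lambda>x. f x 0)) (1 - t / T) * rpow (Lq_norm (ennreal q) (\<lambda>x. f x T)) (t / T)"
proof -
  \<comment> \<open>At the end times \<open>rpow\<close> makes the claim an equality, even for a
    vanishing norm; at interior times both exponents are nonzero and \<open>rpow\<close> is
    \<open>powr\<close>.\<close>
  consider "t = 0" | "t = T" | "t \<in> {0<..<T}" using t by fastforce
  then show ?thesis
  proof cases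
    case 3
    have N: "Lq_norm (ennreal q) (\<lambda>x. f x t) = integral (cbox 0 1) (\<lambda>x. f x t powr q) powr (1 / q)"
      if "t \<in> {0..T}" for t
      using q by (intro Lq_norm_finite cont nonneg that) auto
    let ?I = "\<lambda>t. integral (cbox 0 1) (\<lambda>x. f x t powr q)"
    have pos: "0 \<le> ?I t" if "t \<in> {0..T}" for t
      using q by (intro integral_nonneg integrable_continuous continuous_on_powr' cont that continuous_intros) (auto simp: nonneg[OF that])
    have "?I t powr (1 / q) \<le> (?I 0 powr (1 - t / T) * ?I T powr (t / T)) powr (1 / q)"
      using le[OF 3] pos[OF t] q by (intro powr_mono2) auto
    also have "\<dots> = (?I 0 powr (1 / q)) powr (1 - t / T) * (?I T powr (1 / q)) powr (t / T)"
      by (simp add: powr_mult powr_powr mult.commute)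
    finally show ?thesis using T 3 by (simp add: N rpow_def)
  qed (use T in \<open>simp_all add: rpow_def Lq_norm_nonneg\<close>)
qed

theorem proposition3p1:
  fixes T :: real
    and g :: "real \<Rightarrow> real"
    and H :: "real^'d \<Rightarrow> real"
    and u m :: "real^'d \<Rightarrow> real \<Rightarrow> real"
  assumes "T > 0"
    and "smooth_on g {0..}" and "mono_on {0..} g"
    and "smooth_on H UNIV" and "convex_on UNIV H"
    and "smooth_on (\<lambda>(x, t). u x t) (UNIV \<times> {0..T})"
    and "smooth_on (\<lambda>(x, t). m x t) (UNIV \<times> {0..T})"
    and "\<forall>t\<in>{0..T}. Zn_periodic (\<lambda>x. u x t)"
    and "\<forall>t\<in>{0..T}. Zn_periodic (\<lambda>x. m x t)"
    and "\<forall>x. \<forall>t\<in>{0..T}. m x t \<ge> 0"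
    and "\<forall>x. \<forall>t\<in>{0<..<T}.
           - deriv (\<lambda>s. u x s) t + H (grad (\<lambda>y. u y t) x) = g (m x t)"
    and "\<forall>x. \<forall>t\<in>{0<..<T}.
           deriv (\<lambda>s. m x s) t
             - divergence (\<lambda>y. m y t *\<^sub>R grad H (grad (\<lambda>z. u z t) y)) x = 0"
  shows "\<forall>q::ennreal. 1 \<le> q \<longrightarrow> (\<forall>t\<in>{0..T}.
           Lq_norm q (\<lambda>x. m x t)
             \<le> rpow (Lq_norm q (\<lambda>x. m x 0)) (1 - t / T)
                * rpow (Lq_norm q (\<lambda>x. m x T)) (t / T))"
proof (intro allI impI ballI)
  fix q :: ennreal and t assume q: "1 \<le> q" and t: "t \<in> {0..T}"
  let ?U = "\<lambda>(x, t). u x t" and ?M = "\<lambda>(x, t). m x t"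
  let ?S = "(UNIV :: (real^'d) set) \<times> {0<..<T}"
  have op: "open ?S" by (intro open_Times) auto
  \<comment> \<open>On the open strip the derivatives within the set become ordinary ones, so they
    can be compared with \<open>deriv\<close>, \<open>grad\<close> and
    \<open>divergence\<close>.\<close>
  have U: "smooth_on ?U ?S" and M: "smooth_on ?M ?S"
    using assms(6,7) by (auto elim: smooth_on_subset)
  have Uk: "Ck_on k ?U ?S" and Mk: "Ck_on k ?M ?S" and Hk: "Ck_on k H UNIV" for k
    using U M assms(4) by (simp_all add: smooth_on_def)
  have contM: "continuous_on (UNIV \<times> {0..T}) ?M"
    using assms(7) Ck_on_imp_continuous_on unfolding smooth_on_def by blast
  have slice: "continuous_on (cbox 0 1) (\<lambda>x. m x t)" if "t \<in> {0..T}" for t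
  proof -
    have "continuous_on (cbox 0 1) (\<lambda>x. ?M (x, t))"
      by (rule continuous_on_compose2[OF contM]) (use that in \<open>auto intro!: continuous_intros\<close>)
    then show ?thesis by simp
  qed
  have perU: "space_periodic {0<..<T} ?U" and perM: "space_periodic {0<..<T} ?M"
    using assms(8,9) by (auto intro!: Zn_periodic_imp_space_periodic)
  define p where "p z = (\<chi> j. dx j ?U z)" for z
  define v where "v i z = pderiv_dir (axis i 1) H (p z)" for i z
  have gradH: "grad H y = (\<chi> i. pderiv_dir (axis i 1) H y)" for y
    by (rule grad_eq[OF has_derivative_pderiv_dir[OF Hk open_UNIV UNIV_I]])
  have gradU: "grad (\<lambda>y. u y t) x = p (x, t)" if "t \<in> {0<..<T}" for x t
    using grad_eq[OF has_derivative_space_slice[OF has_derivative_pderiv_dir[OF Uk op]], of x t] that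
    by (simp add: p_def)
  have deriv: "deriv (\<lambda>s. f x s) t = dt (\<lambda>(x, t). f x t) (x, t)"
    if "Ck_on (Suc 0) (\<lambda>(x, t). f x t) ?S" "t \<in> {0<..<T}" for f :: "real^'d \<Rightarrow> real \<Rightarrow> real" and x t
    using has_real_derivative_line[OF that(1) op, of "(x, 0)" t "(0, 1)"] that(2)
    by (intro DERIV_imp_deriv) simp
  have hj: "dt ?U z = H (p z) - g (?M z)" if zS: "z \<in> ?S" for z
  proof -
    obtain x t where z: "z = (x, t)" "t \<in> {0<..<T}" using zS by (cases z) auto
    with assms(11) have "- deriv (\<lambda>s. u x s) t + H (grad (\<lambda>y. u y t) x) = g (m x t)" by blast
    then show ?thesis using z by (simp add: gradU deriv[OF Uk])
  qed
  have vk: "Ck_on k (v i) ?S" for k i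
    unfolding v_def p_def
    by (rule Ck_on_compose_vec[OF Ck_on_pderiv_dir[OF Hk open_UNIV] Ck_on_pderiv_dir[OF Uk op]])
  have continuity: "dt ?M z = (\<Sum>i\<in>UNIV. dx i (\<lambda>z. ?M z * v i z) z)" if zS: "z \<in> ?S" for z
  proof -
    obtain x t where z: "z = (x, t)" "t \<in> {0<..<T}" using zS by (cases z) auto
    have flux: "(\<lambda>y. m y t *\<^sub>R grad H (grad (\<lambda>z. u z t) y)) = (\<lambda>y. \<chi> i. ?M (y, t) * v i (y, t))"
      using z(2) by (simp add: fun_eq_iff vec_eq_iff gradU gradH v_def)
    have "divergence (\<lambda>y. \<chi> i. ?M (y, t) * v i (y, t)) x = (\<Sum>i\<in>UNIV. dx i (\<lambda>z. ?M z * v i z) (x, t))"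
      by (rule divergence_eq[OF has_derivative_space_slice[OF has_derivative_pderiv_dir[OF Ck_on_mult[OF Mk vk] op]]])
        (use z in auto)
    moreover have "deriv (\<lambda>s. m x s) t - divergence (\<lambda>y. m y t *\<^sub>R grad H (grad (\<lambda>z. u z t) y)) x = 0"
      using assms(12) z(2) by blast
    ultimately show ?thesis using z by (simp add: flux deriv[OF Mk])
  qed
  have finite: "Lq_norm (ennreal r) (\<lambda>x. m x t) \<le>
      rpow (Lq_norm (ennreal r) (\<lambda>x. m x 0)) (1 - t / T) * rpow (Lq_norm (ennreal r) (\<lambda>x. m x T)) (t / T)"
    if r: "r \<ge> 1" for r
  proof (rule Lq_norm_interpolation_finite[OF assms(1) r t slice])
    assume t: "t \<in> {0<..<T}"
    show "integral (cbox 0 1) (\<lambda>x. m x t powr r) \<le>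
      integral (cbox 0 1) (\<lambda>x. m x 0 powr r) powr (1 - t / T) *
      integral (cbox 0 1) (\<lambda>x. m x T powr r) powr (t / T)"
      using mfg_Lq_norm_interpolation_finite[OF assms(1) r assms(2-5) U M contM perU perM _ _ _ t] assms(10)
        hj[unfolded p_def] continuity[unfolded v_def p_def]
      by simp
  qed (use assms(10) in auto)
  show "Lq_norm q (\<lambda>x. m x t) \<le>
    rpow (Lq_norm q (\<lambda>x. m x 0)) (1 - t / T) * rpow (Lq_norm q (\<lambda>x. m x T)) (t / T)"
  proof (cases "q = \<infinity>")
    case True
    show ?thesis unfolding True
      by (rule Lq_norm_interpolation_infinity[OF slice _ slice _ slice _ _ _ finite])
        (use assms(1,10) t in auto)
  next
    case False
    then have "q = ennreal (enn2real q)" by (simp add: less_top)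
    moreover from this q have "1 \<le> enn2real q" by (metis ennreal_le_1 ennreal_1 ennreal_le_iff enn2real_nonneg)
    ultimately show ?thesis using finite[of "enn2real q"] by simp
  qed
qed

thm_deps proposition3p1

end
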